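(* Fix $0<p<1$ and let $m=m(n)=\lfloor p\binom n2\rfloor$. Let $\vec G(n,m)$ be the random directed graph on $[n]$ obtained by choosing a graph uniformly at random among all simple graphs on $[n]$ with exactly $m$ edges and then orienting each edge independently in either direction with probability $1/2$. Let $a,s,b,t$ be four distinct fixed vertices, $A$ the event that there is no directed path from $s$ to $a$, and $B$ the event that there is no directed path from $t$ to $b$. Then for all sufficiently large $n$ the events $A$ and $B$ are positively correlated, and the relative covariance satisfies $$\frac{\mathbb{P}(A\cap B)-\mathbb{P}(A)\mathbb{P}(B)}{\mathbb{P}(A\cap B)}\sim 1-\frac{2\left(1-\frac p2\right)^2}{2-\frac p2}\exp\!\left(2\frac{p(1-p)}{(2-p)^2}\right)\quad (n\to\infty).$$
   Context: For functions $f,g$ of $n$, $f\sim g$ means $f/g\to 1$ as $n\to\infty$. Probabilities are taken in the joint probability space of the random graph and the random orientations. *)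

theory Defs
  imports
    "HOL-Probability.Probability"
    "HOL-Library.Landau_Symbols"
    "Graph_Theory.Pair_Digraph"
begin

text \<open>A simple graph on the vertex set $[n] = \{1,\dots,n\}$ is given by its set of edges,
  each edge being a two-element set of vertices.\<close>

definition simple_graphs :: "nat \<Rightarrow> nat \<Rightarrow> nat set set set" where
  "simple_graphs n m = {E. E \<subseteq> {e. e \<subseteq> {1..n} \<and> card e = 2} \<and> card E = m}"

text \<open>An orientation is given by the function \<open>h\<close> selecting the head of each edge.\<close>

definition orient :: "nat \<Rightarrow> nat set set \<Rightarrow> (nat set \<Rightarrow> nat) \<Rightarrow> nat pair_pre_digraph" where
  "orient n E h = \<lparr> pverts = {1..n}, parcs = {(u, v). u \<noteq> v \<and> {u, v} \<in> E \<and> h {u, v} = v} \<rparr>"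

text \<open>The head of each edge is uniform on the two endpoints of that edge, independently for
  different edges; the second argument of \<^const>\<open>Pi_pmf\<close> is only a dummy value outside \<open>E\<close>.
  The uniform distribution on graphs is meaningful only for
  \<^term>\<open>m \<le> n choose 2\<close>, when \<^term>\<open>simple_graphs n m\<close> is nonempty.\<close>

definition random_dgraph :: "nat \<Rightarrow> nat \<Rightarrow> nat pair_pre_digraph pmf" where
  "random_dgraph n m =
     bind_pmf (pmf_of_set (simple_graphs n m))
       (\<lambda>E. map_pmf (orient n E) (Pi_pmf E 0 pmf_of_set))"

definition has_dipath :: "nat pair_pre_digraph \<Rightarrow> nat \<Rightarrow> nat \<Rightarrow> bool" where
  "has_dipath D u v \<longleftrightarrow> (\<exists>P. pre_digraph.apath (with_proj D) u P v)"

definition no_dipath :: "nat \<Rightarrow> nat \<Rightarrow> nat pair_pre_digraph set" where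
  "no_dipath u v = {D. \<not> has_dipath D u v}"

end

theory Submission
  imports Defs "HOL-Real_Asymp.Real_Asymp"
begin

text \<open>There is no directed path from \<open>s\<close> to \<open>a\<close> iff some vertex set containing \<open>s\<close> but not \<open>a\<close> is left by
  no arc. Up to exponentially smaller errors this set is \<open>{s}\<close> or the complement of \<open>{a}\<close>, and for
  \<open>A \<inter> B\<close> the dominant events are: no arc leaves \<open>{s, t}\<close>; no arc enters \<open>{a, b}\<close>; no arc leaves
  \<open>s\<close> and none enters \<open>b\<close>; no arc leaves \<open>t\<close> and none enters \<open>a\<close>. Each of them forbids one
  orientation of \<open>K\<close> pairs, with probability \<open>h K\<close>, the expectation of \<open>2 ^ (- X)\<close> for a
  hypergeometric \<open>X\<close>. Hence \<open>P A\<close> and \<open>P B\<close> are asymptotic to \<open>2 h (n - 1)\<close> and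
  \<open>P (A \<inter> B)\<close> to \<open>2 h (2n - 4) + 2 h (2n - 3)\<close>. A three-term recurrence for \<open>h\<close> determines
  \<open>h (K + 1) / h K\<close> up to \<open>O(1/n\<^sup>2)\<close> for \<open>K \<le> 2n\<close>, and multiplying these ratios gives the limit of
  \<open>h (2n - 2) / (h (n - 1))\<^sup>2\<close>, which is the exponential factor in the theorem.\<close>

section \<open>Elementary symmetric sums with weights one half\<close>

text \<open>With independent edges of density p, \<open>h K\<close> would be q ^ K for q = 1 - p/2,
  and only shared arcs would matter: closing \<open>{s, t}\<close> forbids two arcs fewer than 2(n -
  1), a source with a sink one fewer, so P(A \<inter> B) / (P A * P B) would tend to (1/q^2 +
  1/q)/2. The fixed number of edges works against this: a set of pairs conditioned to avoid an
  orientation tends to hold fewer edges, which makes the remaining pairs denser. Each later ratio of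
  \<open>h\<close> thus drops by a term of order 1/n, and n - 1 such factors leave a constant
  exp(-c). Hence every ratio is needed up to o(1/n). The recurrence gives this without induction on
  K, because the preceding ratio enters only with weight K/(N - K), of order 1/n: a trivial bound
  yields an O(1/n) error, and inserting that once more yields O(1/n^2). Negligible events need no
  such care, since passing from independent edges to exactly m edges costs a polynomial factor. The
  two effects have opposite signs, so positive correlation needs a separate inequality between exp c
  and q.\<close>

definition esym :: "nat \<Rightarrow> ('a \<Rightarrow> real) \<Rightarrow> 'a set \<Rightarrow> real" where
  "esym m w U = (\<Sum>E | E \<subseteq> U \<and> card E = m. \<Prod>e\<in>E. w e)"

lemma prod_monom:
  "finite E \<Longrightarrow> (\<Prod>e\<in>E. monom (w e) (Suc 0)) = monom (\<Prod>e\<in>E. w e :: real) (card E)"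
  by (induction E rule: finite_induct) (auto simp: mult_monom)

lemma esym_eq_coeff:
  assumes "finite U"
  shows "esym m w U = coeff (\<Prod>e\<in>U. [:1, w e:]) m"
proof -
  have "(\<Prod>e\<in>U. [:1, w e:]) = (\<Prod>e\<in>U. monom (w e) (Suc 0) + 1)"
    by (intro prod.cong) (auto simp: monom_Suc monom_0 one_pCons)
  also have "\<dots> = (\<Sum>E\<in>Pow U. (\<Prod>e\<in>E. monom (w e) (Suc 0)) * (\<Prod>e\<in>U - E. 1))"
    using assms by (rule prod_add)
  also have "\<dots> = (\<Sum>E\<in>Pow U. monom (\<Prod>e\<in>E. w e) (card E))"
    using assms by (intro sum.cong) (auto simp: prod_monom finite_subset)
  finally have "coeff (\<Prod>e\<in>U. [:1, w e:]) m = (\<Sum>E\<in>Pow U. if card E = m then \<Prod>e\<in>E. w e else 0)"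
    by (simp add: coeff_sum)
  also have "\<dots> = (\<Sum>E\<in>{E \<in> Pow U. card E = m}. \<Prod>e\<in>E. w e)"
    using assms by (intro sum.inter_filter[symmetric]) auto
  also have "{E \<in> Pow U. card E = m} = {E. E \<subseteq> U \<and> card E = m}" by auto
  finally show ?thesis by (simp add: esym_def)
qed

text \<open>Divided by \<open>N choose m\<close> this is the mean of 2^(-X), where X counts the
  elements of a uniform m-subset of N pairs that fall among K marked ones. The generating function
  form makes a recurrence in \<open>K\<close> available by differentiation.\<close>

definition half_esym :: "nat \<Rightarrow> nat \<Rightarrow> nat \<Rightarrow> real" where
  "half_esym N m K = coeff ([:1, 1/2:] ^ K * [:1, 1:] ^ (N - K)) m"

lemma esym_half:
  assumes "finite U" "S \<subseteq> U" "\<And>e. e \<in> S \<Longrightarrow> w e = 1/2" "\<And>e. e \<in> U - S \<Longrightarrow> w e = 1"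
  shows "esym m w U = half_esym (card U) m (card S)"
proof -
  have "(\<Prod>e\<in>U. [:1, w e:]) = (\<Prod>e\<in>U - S. [:1, w e:]) * (\<Prod>e\<in>S. [:1, w e:])"
    using assms by (simp add: prod.subset_diff)
  also have "\<dots> = (\<Prod>e\<in>U - S. [:1, 1:]) * (\<Prod>e\<in>S. [:1, 1/2:])"
    using assms by (intro arg_cong2[of _ _ _ _ "(*)"] prod.cong) auto
  finally show ?thesis
    using assms by (simp add: esym_eq_coeff half_esym_def card_Diff_subset finite_subset mult.commute)
qed

lemma half_esym_0: "half_esym N m 0 = real (N choose m)"
proof -
  have "half_esym N m 0 = esym m (\<lambda>_. 1) {..<N}"
    using esym_half[of "{..<N}" "{}" "\<lambda>_. 1" m] by simp
  also have "\<dots> = real (card {E. E \<subseteq> {..<N} \<and> card E = m})" by (simp add: esym_def)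
  finally show ?thesis by (simp add: n_subsets)
qed

text \<open>With P the product of the remaining factors, the two quantities are P_m + P_(m-1) and
  P_m + P_(m-1)/2, where the coefficients of P are nonnegative. These are the a priori bounds 1/2
  and 1 on the ratios.\<close>

lemma half_esym_step:
  assumes "K < N"
  shows "half_esym N m (Suc K) \<le> half_esym N m K"
    and "half_esym N m K \<le> 2 * half_esym N m (Suc K)"
proof -
  obtain j where N: "N = K + Suc j" using assms less_iff_Suc_add by auto
  have nn: "coeff ([:1, 1/2:] ^ K * [:1, 1::real:] ^ j) i \<ge> 0" for i
  proof -
    have pos: "coeff (p * q) i \<ge> 0" if "\<And>i. coeff p i \<ge> 0" "\<And>i. coeff q i \<ge> 0" for p q :: "real poly" and i
      unfolding coeff_mult by (intro sum_nonneg mult_nonneg_nonneg that)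
    have pw: "coeff (p ^ k) i \<ge> 0" if "\<And>i. coeff p i \<ge> 0" for p :: "real poly" and k i
      using that by (induction k arbitrary: i) (auto intro!: pos)
    show ?thesis by (intro pos pw) (auto simp: coeff_pCons split: nat.splits)
  qed
  define P where "P = [:1, 1/2:] ^ K * [:1, 1::real:] ^ j"
  have a: "half_esym N m K = coeff ([:1,1:] * P) m" "half_esym N m (Suc K) = coeff ([:1,1/2:] * P) m"
    by (simp_all add: half_esym_def N P_def algebra_simps)
  have "coeff P i \<ge> 0" for i using nn by (simp add: P_def)
  then show "half_esym N m (Suc K) \<le> half_esym N m K" "half_esym N m K \<le> 2 * half_esym N m (Suc K)"
    unfolding a by (auto simp: coeff_pCons split: nat.splits)
qed

text \<open>A contiguous relation of the hypergeometric function \<open>2F1(-K, -m; -N; 1/2)\<close>. It comes from a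
  linear relation between \<open>u\<^sup>2\<close>, \<open>u v\<close>, \<open>v\<^sup>2\<close> and the logarithmic derivative of \<open>u ^ K * v ^ (N - K)\<close>,
  where \<open>u = 1 + z/2\<close> and \<open>v = 1 + z\<close>.\<close>

lemma half_esym_recurrence:
  assumes "0 < K" "K < N"
  shows "real (N - K) * half_esym N m (Suc K) =
    (real N - 3 / 2 * real K - real m / 2) * half_esym N m K + real K / 2 * half_esym N m (K - 1)"
proof -
  obtain i where K: "K = Suc i" using assms by (cases K) auto
  obtain j where N: "N = K + Suc j" using assms less_iff_Suc_add by auto
  define u v z where "u = [:1, 1/2::real:]" and "v = [:1, 1::real:]" and "z = [:0, 1::real:]"
  define Q where "Q = u ^ i * v ^ j"
  define P where "P = u * v * Q"
  have z_u: "z = smult 2 (u - 1)" and v_u: "v = smult 2 u - 1"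
    by (simp_all add: u_def v_def z_def one_pCons)
  have e: "half_esym N m K = coeff P m" "half_esym N m (Suc K) = coeff (u * u * Q) m"
    "half_esym N m (K - 1) = coeff (v * v * Q) m"
    unfolding half_esym_def P_def Q_def u_def[symmetric] v_def[symmetric] K N by (simp_all add: ac_simps)
  have du: "pderiv u = [:1/2:]" and dv: "pderiv v = 1"
    by (simp_all add: u_def v_def pderiv_pCons one_pCons)
  have P': "P = u ^ Suc i * v ^ Suc j" by (simp add: P_def Q_def ac_simps)
  have "pderiv P = smult (real (Suc i)) (u ^ i) * [:1/2:] * v ^ Suc j + u ^ Suc i * smult (real (Suc j)) (v ^ j)"
    unfolding P' pderiv_mult pderiv_power_Suc du dv by (simp add: ac_simps)
  also have "\<dots> = smult (real K / 2) (v * Q) + smult (real (N - K)) (u * Q)"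
    by (simp add: K N Q_def ac_simps)
  finally have dP: "pderiv P = smult (real K / 2) (v * Q) + smult (real (N - K)) (u * Q)" .
  \<comment> \<open>The operator \<open>z * pderiv\<close> multiplies the coefficient of degree
    \<open>m\<close> by \<open>m\<close>; this is how \<open>m\<close> enters the
    recurrence.\<close>
  have mP: "real m * coeff P m = coeff (z * pderiv P) m"
    by (cases m) (auto simp: z_def coeff_pderiv)
  \<comment> \<open>With N - 3K/2 written as (N - K) - K/2, the terms with factor N - K and those
    with factor K each reduce to u = v - z/2.\<close>
  have "smult (real (N - K)) (u * u * Q) = smult (real N - 3 / 2 * real K) P
     - smult (1/2) (z * pderiv P) + smult (real K / 2) (v * v * Q)"
  proof -
    have NK: "real (N - K) = real N - real K" using assms by simp
    show ?thesis unfolding dP unfolding P_def z_u v_u NK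
      apply (rule poly_eq_poly_eq_iff[THEN iffD1])
      apply (rule ext)
      apply (simp add: field_simps)
      done
  qed
  then have "coeff (smult (real (N - K)) (u * u * Q)) m = coeff (smult (real N - 3 / 2 * real K) P
     - smult (1/2) (z * pderiv P) + smult (real K / 2) (v * v * Q)) m" by simp
  then show ?thesis unfolding e by (simp add: mP[symmetric] algebra_simps)
qed

text \<open>The case K = 0 of the recurrence, where the term with index \<open>K - 1\<close> is
  absent: a single pair is an edge with probability m/N and then costs a factor 1/2.\<close>

lemma half_esym_1:
  assumes "0 < N"
  shows "real N * half_esym N m 1 = (real N - real m / 2) * half_esym N m 0"
proof -
  obtain j where N: "N = Suc j" using assms by (cases N) auto
  define P where "P = [:1, 1::real:] ^ N"
  have dP: "pderiv P = smult (real N) ([:1, 1:] ^ j)"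
    unfolding P_def N pderiv_power_Suc by (simp add: pderiv_pCons)
  have mP: "real m * coeff P m = coeff ([:0,1:] * pderiv P) m"
    by (cases m) (auto simp: coeff_pderiv)
  have "smult (real N) ([:1, 1/2:] * [:1,1:] ^ j) = smult (real N) P - smult (1/2) ([:0,1:] * pderiv P)"
    unfolding dP unfolding P_def N
      apply (rule poly_eq_poly_eq_iff[THEN iffD1])
      apply (rule ext)
      apply (simp add: field_simps)
      done
  then have "coeff (smult (real N) ([:1, 1/2:] * [:1,1:] ^ j)) m = coeff (smult (real N) P - smult (1/2) ([:0,1:] * pderiv P)) m"
    by simp
  then show ?thesis unfolding coeff_diff coeff_smult mP[symmetric] 
    by (simp add: half_esym_def N P_def algebra_simps)
qed

lemma half_esym_pos:
  assumes "m \<le> N" "K \<le> N" shows "half_esym N m K > 0"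
  using assms(2)
proof (induction K)
  case 0 then show ?case using assms by (simp add: half_esym_0)
next
  case (Suc K) then show ?case using half_esym_step(2)[of K N m] by auto
qed

text \<open>The binomial distribution with integer mean m = N\<rho> increases up to m and decreases
  afterwards, so its value at m is the largest of N + 1 values with sum 1.\<close>

lemma binomial_mode:
  assumes "m \<le> N" "0 < N"
  defines "\<rho> \<equiv> real m / real N"
  shows "1 \<le> real (N + 1) * (real (N choose m) * \<rho> ^ m * (1 - \<rho>) ^ (N - m))"
proof -
  define T where "T k = real (N choose k) * \<rho> ^ k * (1 - \<rho>) ^ (N - k)" for k
  have r: "0 \<le> \<rho>" "\<rho> \<le> 1" using assms by (auto simp: \<rho>_def)
  have T0: "T k \<ge> 0" for k using r by (simp add: T_def)
  \<comment> \<open>The ratio of neighbouring terms in cross-multiplied form, valid also for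
    densities 0 and 1.\<close>
  have rec: "real (Suc k) * (1 - \<rho>) * T (Suc k) = real (N - k) * \<rho> * T k" if "k < N" for k
  proof -
    have 1: "real (Suc k) * real (N choose Suc k) = real (N - k) * real (N choose k)"
      using binomial_absorb_comp[of N k] binomial_absorption[of k N] that
      by (metis (no_types, lifting) Suc_times_binomial_eq binomial_absorb_comp of_nat_mult mult.commute times_binomial_minus1_eq binomial_absorption)
    have 2: "N - k = Suc (N - Suc k)" using that by simp
    have "real (Suc k) * (1 - \<rho>) * T (Suc k) = (real (Suc k) * real (N choose Suc k)) * \<rho> ^ Suc k * ((1 - \<rho>) * (1 - \<rho>) ^ (N - Suc k))"
      by (simp add: T_def ac_simps)
    also have "(1 - \<rho>) * (1 - \<rho>) ^ (N - Suc k) = (1 - \<rho>) ^ (N - k)" using 2 by simp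
    finally show ?thesis unfolding 1 by (simp add: T_def ac_simps)
  qed
  have N\<rho>: "real m = real N * \<rho>" using assms by (simp add: \<rho>_def)
  have up: "T k \<le> T (Suc k)" if "k < m" for k
  proof -
    have "real (Suc k) * (1 - \<rho>) \<le> real m * (1 - \<rho>)"
      using that r by (intro mult_right_mono) auto
    also have "\<dots> = real (N - m) * \<rho>" using assms by (simp add: N\<rho> of_nat_diff algebra_simps)
    also have "\<dots> \<le> real (N - k) * \<rho>" using that r by (intro mult_right_mono) auto
    finally have le: "real (Suc k) * (1 - \<rho>) \<le> real (N - k) * \<rho>" .
    have pos: "real (N - k) * \<rho> > 0" using that assms by (simp add: \<rho>_def)
    have "real (N - k) * \<rho> * T k \<le> real (N - k) * \<rho> * T (Suc k)"
      using rec[of k] that assms mult_right_mono[OF le T0[of "Suc k"]] by simp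
    then show ?thesis using pos by (rule mult_left_le_imp_le)
  qed
  have down: "T (Suc k) \<le> T k" if "m \<le> k" "k < N" for k
  proof -
    have "real (N - k) * \<rho> \<le> real (N - m) * \<rho>" using that r by (intro mult_right_mono) auto
    also have "\<dots> = real m * (1 - \<rho>)" using assms by (simp add: N\<rho> of_nat_diff algebra_simps)
    also have "\<dots> \<le> real (Suc k) * (1 - \<rho>)" using that r by (intro mult_right_mono) auto
    finally have le: "real (N - k) * \<rho> \<le> real (Suc k) * (1 - \<rho>)" .
    have "\<rho> < 1" using that assms by (simp add: \<rho>_def)
    then have pos: "real (Suc k) * (1 - \<rho>) > 0" by simp
    have "real (Suc k) * (1 - \<rho>) * T (Suc k) \<le> real (Suc k) * (1 - \<rho>) * T k"
      using rec[of k] that mult_right_mono[OF le T0[of k]] by simp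
    then show ?thesis using pos by (rule mult_left_le_imp_le)
  qed
  have le: "T k \<le> T m" if "k \<le> N" for k
  proof (cases "k \<le> m")
    case True
    then show ?thesis by (induction k rule: inc_induct) (auto intro: order_trans[OF up])
  next
    case False
    then have "m \<le> k" by simp
    then show ?thesis using that
      by (induction k rule: dec_induct) (auto intro: order_trans[OF down])
  qed
  have "1 = (\<rho> + (1 - \<rho>)) ^ N" by simp
  also have "\<dots> = (\<Sum>k\<le>N. T k)" unfolding T_def by (subst binomial_ring) simp
  also have "\<dots> \<le> (\<Sum>k\<le>N. T m)" by (intro sum_mono le) simp
  finally show ?thesis by (simp add: T_def)
qed

text \<open>Conditioning independent edges of density \<open>\<rho>\<close> on their number being \<open>m\<close> costs at most a factor
  \<open>N + 1\<close>, since \<open>m\<close> is the mode of the binomial distribution. This crude bound suffices for all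
  events that are exponentially less likely than the main terms.\<close>

lemma esym_le:
  assumes "finite U" "m \<le> card U" "U \<noteq> {}" "\<And>e. e \<in> U \<Longrightarrow> 0 \<le> w e"
  defines "\<rho> \<equiv> real m / real (card U)"
  shows "esym m w U / real (card U choose m) \<le> real (card U + 1) * (\<Prod>e\<in>U. 1 - \<rho> + \<rho> * w e)"
proof -
  let ?N = "card U"
  have N: "0 < ?N" using assms by (simp add: card_gt_0_iff)
  have r: "0 \<le> \<rho>" "\<rho> \<le> 1" using assms N by (auto simp: \<rho>_def)
  let ?g = "\<lambda>E. (\<Prod>e\<in>E. \<rho> * w e) * (\<Prod>e\<in>U - E. 1 - \<rho>)"
  have "\<rho> ^ m * (1 - \<rho>) ^ (?N - m) * esym m w U = (\<Sum>E | E \<subseteq> U \<and> card E = m. ?g E)"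
    unfolding esym_def sum_distrib_left
    using assms(1) by (intro sum.cong) (auto simp: prod.distrib card_Diff_subset finite_subset)
  \<comment> \<open>Dropping the condition on the size of \<open>E\<close> only adds nonnegative
    terms, and the full sum is the expansion of a product.\<close>
  also have "\<dots> \<le> (\<Sum>E\<in>Pow U. ?g E)"
    using assms r by (intro sum_mono2) (auto intro!: mult_nonneg_nonneg prod_nonneg)
  also have "\<dots> = (\<Prod>e\<in>U. \<rho> * w e + (1 - \<rho>))" using assms(1) by (rule prod_add[symmetric])
  finally have a: "\<rho> ^ m * (1 - \<rho>) ^ (?N - m) * esym m w U \<le> (\<Prod>e\<in>U. 1 - \<rho> + \<rho> * w e)"
    by (simp add: ac_simps)
  have C: "real (?N choose m) > 0" using assms by simp
  have e0: "esym m w U \<ge> 0" unfolding esym_def using assms by (intro sum_nonneg prod_nonneg) auto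
  have "esym m w U / (?N choose m) * 1 \<le> esym m w U / (?N choose m) *
      (real (?N + 1) * (real (?N choose m) * \<rho> ^ m * (1 - \<rho>) ^ (?N - m)))"
    unfolding \<rho>_def using assms N e0 by (intro mult_left_mono binomial_mode) auto
  also have "\<dots> = real (?N + 1) * (\<rho> ^ m * (1 - \<rho>) ^ (?N - m) * esym m w U)"
    using C by (simp add: field_simps)
  also have "\<dots> \<le> real (?N + 1) * (\<Prod>e\<in>U. 1 - \<rho> + \<rho> * w e)"
    using a by (intro mult_left_mono) auto
  finally show ?thesis by simp
qed

section \<open>Avoiding a set of arcs\<close>

abbreviation undir :: "'a \<times> 'a \<Rightarrow> 'a set" where
  "undir a \<equiv> {fst a, snd a}"

definition vertex_pairs :: "nat \<Rightarrow> nat set set" where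
  "vertex_pairs n = {e. e \<subseteq> {1..n} \<and> card e = 2}"

lemma finite_vertex_pairs [simp]: "finite (vertex_pairs n)"
  by (rule finite_subset[of _ "Pow {1..n}"]) (auto simp: vertex_pairs_def)

lemma card_vertex_pairs [simp]: "card (vertex_pairs n) = n choose 2"
  using n_subsets[of "{1..n}" 2] by (simp add: vertex_pairs_def)

lemma simple_graphs_eq: "simple_graphs n m = {E. E \<subseteq> vertex_pairs n \<and> card E = m}"
  by (simp add: simple_graphs_def vertex_pairs_def)

lemma finite_simple_graphs [simp]: "finite (simple_graphs n m)"
  by (rule finite_subset[of _ "Pow (vertex_pairs n)"]) (auto simp: simple_graphs_eq)

lemma card_simple_graphs: "card (simple_graphs n m) = (n choose 2) choose m"
  using n_subsets[of "vertex_pairs n" m] by (simp add: simple_graphs_eq)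

definition avoiding :: "(nat \<times> nat) set \<Rightarrow> nat pair_pre_digraph set" where
  "avoiding F = {D. parcs D \<inter> F = {}}"

definition arc_set :: "nat \<Rightarrow> (nat \<times> nat) set" where
  "arc_set n = {(u, v). u \<in> {1..n} \<and> v \<in> {1..n} \<and> u \<noteq> v}"

text \<open>The probability that \<open>e\<close>, if it is an edge, is not oriented as an arc of
  \<open>F\<close>: each orientation in \<open>F\<close> removes 1/2.\<close>

definition fiber_weight :: "('a \<times> 'a) set \<Rightarrow> 'a set \<Rightarrow> real" where
  "fiber_weight F e = 1 - real (card {a \<in> F. undir a = e}) / 2"

lemma finite_arc_set [simp]: "finite (arc_set n)"
  by (rule finite_subset[of _ "{1..n} \<times> {1..n}"]) (auto simp: arc_set_def)

lemma undir_arc_set: "a \<in> arc_set n \<Longrightarrow> undir a \<in> vertex_pairs n"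
  by (auto simp: arc_set_def vertex_pairs_def)

lemma prob_orientation_allowed:
  assumes "F \<subseteq> arc_set n" "card e = 2"
  shows "measure_pmf.prob (pmf_of_set e) {v. \<forall>u. u \<noteq> v \<and> {u, v} = e \<longrightarrow> (u, v) \<notin> F} = fiber_weight F e"
    (is "measure_pmf.prob _ ?B = _")
proof -
  have fin: "finite e" "e \<noteq> {}" using assms(2) card.infinite by fastforce+
  have "e - ?B = snd ` {a \<in> F. undir a = e}" (is "_ = snd ` ?F")
  proof (intro equalityI subsetI)
    fix v assume "v \<in> e - ?B"
    then obtain u where "u \<noteq> v" "{u, v} = e" "(u, v) \<in> F" by auto
    then show "v \<in> snd ` ?F" by (intro image_eqI[of _ _ "(u, v)"]) auto
  next
    fix v assume "v \<in> snd ` ?F"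
    then obtain u where "(u, v) \<in> F" "{u, v} = e" by auto
    moreover have "u \<noteq> v" using \<open>(u, v) \<in> F\<close> assms(1) by (auto simp: arc_set_def)
    ultimately show "v \<in> e - ?B" by auto
  qed
  moreover have "inj_on snd ?F"
    using assms(1) by (auto simp: inj_on_def arc_set_def doubleton_eq_iff)
  ultimately have "card (e - ?B) = card ?F" by (simp add: card_image)
  moreover have "card e = card (e \<inter> ?B) + card (e - ?B)"
    using fin(1) by (rule card_Int_Diff)
  ultimately have "real (card (e \<inter> ?B)) = 2 - real (card ?F)" using assms(2) by simp
  then show ?thesis
    using fin assms(2) by (simp add: measure_pmf_of_set fiber_weight_def diff_divide_distrib)
qed

lemma measure_bind_pmf_of_set:
  assumes "finite A" "A \<noteq> {}"
  shows "measure_pmf.prob (bind_pmf (pmf_of_set A) f) X = (\<Sum>a\<in>A. measure_pmf.prob (f a) X) / real (card A)"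
proof -
  have "ennreal (measure_pmf.prob (bind_pmf (pmf_of_set A) f) X) =
      (\<Sum>a\<in>A. emeasure (measure_pmf (f a)) X) / ennreal (real (card A))"
    using assms by (simp add: measure_pmf.emeasure_eq_measure[symmetric] nn_integral_pmf_of_set ennreal_of_nat_eq_real_of_nat)
  also have "\<dots> = ennreal ((\<Sum>a\<in>A. measure_pmf.prob (f a) X) / real (card A))"
    using assms by (simp add: measure_pmf.emeasure_eq_measure sum_ennreal divide_ennreal sum_nonneg card_gt_0_iff)
  finally show ?thesis by (subst (asm) ennreal_inj) (auto intro!: divide_nonneg_nonneg sum_nonneg)
qed

text \<open>Given the edge set, the heads are independent, so the conditional probability is a
  product of weights over the edges; averaging over all edge sets of size \<open>m\<close> gives the
  symmetric sum.\<close>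

lemma prob_avoiding:
  assumes "F \<subseteq> arc_set n" "m \<le> n choose 2"
  shows "measure_pmf.prob (random_dgraph n m) (avoiding F) =
    esym m (fiber_weight F) (vertex_pairs n) / real ((n choose 2) choose m)"
proof -
  have ne: "simple_graphs n m \<noteq> {}"
  proof -
    have "card (simple_graphs n m) > 0" using assms(2) by (simp add: card_simple_graphs)
    then show ?thesis by (simp only: card_gt_0_iff not_False_eq_True)
  qed
  have "measure_pmf.prob (map_pmf (orient n E) (Pi_pmf E 0 pmf_of_set)) (avoiding F) = (\<Prod>e\<in>E. fiber_weight F e)"
    if E: "E \<in> simple_graphs n m" for E
  proof -
    have E': "E \<subseteq> vertex_pairs n" "finite E"
      using E by (auto simp: simple_graphs_eq intro: finite_subset)
    let ?B = "\<lambda>e. {v. \<forall>u. u \<noteq> v \<and> {u, v} = e \<longrightarrow> (u, v) \<notin> F}"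
    \<comment> \<open>Avoiding \<open>F\<close> is a condition on the head of each edge separately,
      which is what independence under \<open>Pi_pmf\<close> requires.\<close>
    have "orient n E -` avoiding F = Pi E ?B"
    proof -
      have "parcs (orient n E h) \<inter> F = {} \<longleftrightarrow> h \<in> Pi E ?B" for h
      proof -
        have "parcs (orient n E h) \<inter> F = {} \<longleftrightarrow>
            (\<forall>u v. u \<noteq> v \<and> {u, v} \<in> E \<and> h {u, v} = v \<longrightarrow> (u, v) \<notin> F)"
          unfolding orient_def by auto
        also have "\<dots> \<longleftrightarrow> (\<forall>e\<in>E. \<forall>u. u \<noteq> h e \<and> {u, h e} = e \<longrightarrow> (u, h e) \<notin> F)"
          by metis
        finally show ?thesis by auto
      qed
      then show ?thesis by (auto simp: avoiding_def)
    qed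
    then have "measure_pmf.prob (map_pmf (orient n E) (Pi_pmf E 0 pmf_of_set)) (avoiding F) =
        measure_pmf.prob (Pi_pmf E 0 pmf_of_set) (Pi E ?B)" by simp
    also have "\<dots> = (\<Prod>e\<in>E. measure_pmf.prob (pmf_of_set e) (?B e))"
      using E' by (intro measure_Pi_pmf_Pi)
    also have "\<dots> = (\<Prod>e\<in>E. fiber_weight F e)"
      using E' by (intro prod.cong refl prob_orientation_allowed[OF assms(1)]) (auto simp: vertex_pairs_def)
    finally show ?thesis .
  qed
  then show ?thesis using ne
    by (simp add: random_dgraph_def measure_bind_pmf_of_set card_simple_graphs esym_def
        simple_graphs_eq[symmetric])
qed

text \<open>This is \<open>h K\<close> of the overview, for \<open>N\<close> pairs and
  \<open>m\<close> edges.\<close>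

definition half_prob :: "nat \<Rightarrow> nat \<Rightarrow> nat \<Rightarrow> real" where
  "half_prob N m K = half_esym N m K / real (N choose m)"

text \<open>Antisymmetry makes \<open>undir\<close> injective on \<open>F\<close>: no pair is
  forbidden in both directions, so exactly \<open>card F\<close> pairs have weight 1/2 and all
  others weight 1.\<close>

lemma prob_avoiding_eq:
  assumes "F \<subseteq> arc_set n" "m \<le> n choose 2" "antisym F"
  shows "measure_pmf.prob (random_dgraph n m) (avoiding F) = half_prob (n choose 2) m (card F)"
proof -
  have inj: "inj_on undir F"
    using assms(1,3) by (auto simp: inj_on_def doubleton_eq_iff dest: antisymD) 
  have "esym m (fiber_weight F) (vertex_pairs n) = half_esym (card (vertex_pairs n)) m (card (undir ` F))"
  proof (rule esym_half)
    show "undir ` F \<subseteq> vertex_pairs n" using assms(1) undir_arc_set by blast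
    show "fiber_weight F e = 1 / 2" if "e \<in> undir ` F" for e
    proof -
      obtain a where "a \<in> F" "e = undir a" using \<open>e \<in> undir ` F\<close> by auto
      then have "{a \<in> F. undir a = e} = {a}" using inj by (auto simp: inj_on_def)
      then show ?thesis unfolding fiber_weight_def by simp
    qed
    show "fiber_weight F e = 1" if "e \<in> vertex_pairs n - undir ` F" for e
    proof -
      have "{a \<in> F. undir a = e} = {}" using that by blast
      then show ?thesis unfolding fiber_weight_def by (simp only: card.empty)
    qed
  qed simp
  then show ?thesis using assms inj
    by (simp add: prob_avoiding half_prob_def card_image)
qed

text \<open>A pair forbidden in both directions contributes \<open>1 - \<rho> \<le> (1 - \<rho> / 2)\<^sup>2\<close>, so only the number of
  forbidden arcs matters.\<close>

lemma prob_avoiding_le: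
  assumes "F \<subseteq> arc_set n" "m \<le> n choose 2" "2 \<le> n"
  shows "measure_pmf.prob (random_dgraph n m) (avoiding F) \<le>
    real ((n choose 2) + 1) * (1 - real m / real (n choose 2) / 2) ^ card F"
proof -
  let ?U = "vertex_pairs n"
  define \<rho> where "\<rho> = real m / real (n choose 2)"
  have r: "0 \<le> \<rho>" "\<rho> \<le> 1" using assms(2) by (auto simp: \<rho>_def divide_le_eq)
  have finF: "finite F" using assms(1) by (rule finite_subset) simp
  have c2: "card {a \<in> F. undir a = e} \<le> 2" if e: "e \<in> ?U" for e
  proof -
    obtain x y where xy: "e = {x, y}" "x \<noteq> y" using e by (auto simp: vertex_pairs_def card_2_iff)
    have "{a \<in> F. undir a = e} \<subseteq> {(x, y), (y, x)}"
      unfolding xy by (auto simp: doubleton_eq_iff)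
    then have "card {a \<in> F. undir a = e} \<le> card {(x, y), (y, x)}" by (intro card_mono) auto
    also have "\<dots> = 2" using xy(2) by simp
    finally show ?thesis .
  qed
  have "card ?U > 0" using assms(3) by simp
  then have ne: "?U \<noteq> {}" by (simp only: card_gt_0_iff not_False_eq_True)
  have "(\<Prod>e\<in>?U. 1 - \<rho> + \<rho> * fiber_weight F e) \<le> (\<Prod>e\<in>?U. (1 - \<rho> / 2) ^ card {a \<in> F. undir a = e})"
  proof (rule prod_mono)
    fix e assume e: "e \<in> ?U"
    consider "card {a \<in> F. undir a = e} = 0" | "card {a \<in> F. undir a = e} = 1" | "card {a \<in> F. undir a = e} = 2"
      using c2[OF e] by linarith
    then show "0 \<le> 1 - \<rho> + \<rho> * fiber_weight F e \<and> 1 - \<rho> + \<rho> * fiber_weight F e \<le> (1 - \<rho> / 2) ^ card {a \<in> F. undir a = e}"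
      unfolding fiber_weight_def
      by cases (use r in \<open>auto simp: power2_eq_square algebra_simps\<close>)
  qed
  also have "\<dots> = (1 - \<rho> / 2) ^ (\<Sum>e\<in>?U. card {a \<in> F. undir a = e})"
    by (simp add: power_sum)
  also have "(\<Sum>e\<in>?U. card {a \<in> F. undir a = e}) = card F"
  proof -
    have "undir ` F \<subseteq> vertex_pairs n" using assms(1) undir_arc_set by blast
    from sum.group[OF finF finite_vertex_pairs this, of "\<lambda>_. 1 :: nat"] show ?thesis by simp
  qed
  finally have le: "(\<Prod>e\<in>?U. 1 - \<rho> + \<rho> * fiber_weight F e) \<le> (1 - \<rho> / 2) ^ card F" .
  have "esym m (fiber_weight F) ?U / real (card ?U choose m) \<le>
      real (card ?U + 1) * (\<Prod>e\<in>?U. 1 - real m / real (card ?U) + real m / real (card ?U) * fiber_weight F e)"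
  proof (rule esym_le)
    show "0 \<le> fiber_weight F e" if "e \<in> ?U" for e
      using c2[OF that] by (simp add: fiber_weight_def)
  qed (use assms ne in auto)
  also have "\<dots> \<le> real ((n choose 2) + 1) * (1 - \<rho> / 2) ^ card F"
    unfolding card_vertex_pairs \<rho>_def[symmetric] by (intro mult_left_mono le) simp
  finally show ?thesis using assms by (simp add: prob_avoiding \<rho>_def)
qed

section \<open>Vertex sets left by no arc\<close>

definition closed_event :: "nat \<Rightarrow> nat set \<Rightarrow> nat pair_pre_digraph set" where
  "closed_event n S = avoiding (S \<times> ({1..n} - S))"

definition valid_dgraph :: "nat \<Rightarrow> nat pair_pre_digraph \<Rightarrow> bool" where
  "valid_dgraph n D \<longleftrightarrow> pverts D = {1..n} \<and> parcs D \<subseteq> arc_set n"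

lemma closed_event_iff:
  "D \<in> closed_event n S \<longleftrightarrow> (\<forall>(u, v)\<in>parcs D. u \<in> S \<longrightarrow> v \<in> {1..n} \<longrightarrow> v \<in> S)"
  unfolding closed_event_def avoiding_def by auto

lemma closed_event_Un: "D \<in> closed_event n S \<Longrightarrow> D \<in> closed_event n T \<Longrightarrow> D \<in> closed_event n (S \<union> T)"
  and closed_event_Int: "D \<in> closed_event n S \<Longrightarrow> D \<in> closed_event n T \<Longrightarrow> D \<in> closed_event n (S \<inter> T)"
  unfolding closed_event_iff by blast+

lemma avoiding_Un: "avoiding (F \<union> G) = avoiding F \<inter> avoiding G"
  unfolding avoiding_def by auto

lemma valid_random_dgraph:
  assumes "m \<le> n choose 2" "D \<in> set_pmf (random_dgraph n m)"
  shows "valid_dgraph n D"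
proof -
  have "card (simple_graphs n m) > 0" using assms(1) by (simp add: card_simple_graphs)
  then have "simple_graphs n m \<noteq> {}" by (simp only: card_gt_0_iff not_False_eq_True)
  then obtain E h where E: "E \<in> simple_graphs n m" "D = orient n E h"
    using assms(2) by (auto simp: random_dgraph_def)
  have "(u, v) \<in> arc_set n" if "u \<noteq> v" "{u, v} \<in> E" for u v
    using E(1) that unfolding simple_graphs_def arc_set_def by blast
  then show ?thesis by (auto simp: valid_dgraph_def E(2) orient_def)
qed

text \<open>The witness is the set of vertices reachable from \<open>u\<close>; conversely, a set
  that no arc leaves traps every path starting in it.\<close>

lemma no_dipath_iff:
  assumes "valid_dgraph n D" "u \<in> {1..n}" "v \<in> {1..n}"
  shows "D \<in> no_dipath u v \<longleftrightarrow> (\<exists>S\<subseteq>{1..n}. u \<in> S \<and> v \<notin> S \<and> D \<in> closed_event n S)"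
proof -
  interpret pair_wf_digraph D
    using assms(1) by unfold_locales (auto simp: valid_dgraph_def arc_set_def)
  have verts: "pverts D = {1..n}" using assms(1) by (simp add: valid_dgraph_def)
  have reach: "has_dipath D u v \<longleftrightarrow> u \<rightarrow>\<^sup>*\<^bsub>with_proj D\<^esub> v"
    unfolding has_dipath_def reachable_awalk using apath_awalk_to_apath awalkI_apath by blast
  show ?thesis
  proof
    assume "D \<in> no_dipath u v"
    then have "\<not> u \<rightarrow>\<^sup>*\<^bsub>with_proj D\<^esub> v" using reach by (simp add: no_dipath_def)
    moreover have "D \<in> closed_event n {w. u \<rightarrow>\<^sup>*\<^bsub>with_proj D\<^esub> w}"
      unfolding closed_event_iff by (auto intro: reachable_adj_trans)
    moreover have "{w. u \<rightarrow>\<^sup>*\<^bsub>with_proj D\<^esub> w} \<subseteq> {1..n}"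
      using reachable_in_verts(2) verts by auto
    moreover have "u \<rightarrow>\<^sup>*\<^bsub>with_proj D\<^esub> u" using assms(2) verts by (simp add: reachable_refl)
    ultimately show "\<exists>S\<subseteq>{1..n}. u \<in> S \<and> v \<notin> S \<and> D \<in> closed_event n S" by blast
  next
    assume "\<exists>S\<subseteq>{1..n}. u \<in> S \<and> v \<notin> S \<and> D \<in> closed_event n S"
    then obtain S where S: "u \<in> S" "v \<notin> S" "D \<in> closed_event n S" by blast
    have "w \<in> S" if "u \<rightarrow>\<^sup>*\<^bsub>with_proj D\<^esub> w" for w
      using that
    proof (induction rule: reachable_induct)
      case base then show ?case using S by simp
    next
      case (step x y)
      then show ?case using S(3) in_arcsD2 verts unfolding closed_event_iff by fastforce
    qed
    then show "D \<in> no_dipath u v" using S reach by (auto simp: no_dipath_def)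
  qed
qed

text \<open>Sets with at least \<open>j\<close> vertices on both sides. For \<open>j = 2\<close> the
  event is negligible against one vertex being a source or sink of the kind in question, for
  \<open>j = 3\<close> against two.\<close>

definition middle_closed :: "nat \<Rightarrow> nat \<Rightarrow> nat pair_pre_digraph set" where
  "middle_closed n j = (\<Union>S\<in>{S. S \<subseteq> {1..n} \<and> j \<le> card S \<and> card S + j \<le> n}. closed_event n S)"

text \<open>No arc leaves \<open>S\<close> and no arc enters \<open>T\<close>.\<close>

definition source_sink :: "nat \<Rightarrow> nat set \<Rightarrow> nat set \<Rightarrow> nat pair_pre_digraph set" where
  "source_sink n S T = closed_event n S \<inter> closed_event n ({1..n} - T)"

text \<open>The sets have one or two elements, since the entries of a pair may coincide; three
  isolated sides in total forbid about 3n arcs. Indexing by quadruples of vertices bounds the number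
  of events by n^4.\<close>

definition large_source_sink :: "nat \<Rightarrow> nat pair_pre_digraph set" where
  "large_source_sink n = (\<Union>(x, y, x', y')\<in>{(x, y, x', y'). {x, y, x', y'} \<subseteq> {1..n} \<and>
     3 \<le> card {x, y} + card {x', y'}}. source_sink n {x, y} {x', y'})"

lemma large_source_sinkI:
  assumes "D \<in> source_sink n S T" "S = {x, y}" "T = {x', y'}" "{x, y, x', y'} \<subseteq> {1..n}"
    "x \<noteq> y \<or> x' \<noteq> y'"
  shows "D \<in> large_source_sink n"
proof -
  have "card {x, y} + card {x', y'} \<ge> 3" using assms(5) by (auto simp: card_insert_if)
  then show ?thesis using assms unfolding large_source_sink_def by blast
qed

lemma card_le_2_cases:
  assumes "card S \<le> 2" "s \<in> S" "finite S"
  obtains x where "S = {s, x}"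
proof -
  have "card (S - {s}) \<le> 1" using assms by simp
  then consider "S - {s} = {}" | x where "S - {s} = {x}"
    using assms by (metis card_1_singletonE card_0_eq finite_Diff le_antisym less_one linorder_not_le nless_le)
  then show ?thesis
  proof cases
    case 1 then have "S = {s, s}" using assms by auto
    then show ?thesis by (rule that)
  next
    case (2 x) then have "S = {s, x}" using assms by auto
    then show ?thesis by (rule that)
  qed
qed

text \<open>Outside \<open>middle_closed n 2\<close>, a separating set must be \<open>{s}\<close> or
  the complement of \<open>{a}\<close>. Excluding \<open>source_sink\<close> makes the two cases
  disjoint, so that indicators add without a correction term.\<close>

lemma no_dipath_eq_indicator:
  assumes "valid_dgraph n D" "s \<in> {1..n}" "a \<in> {1..n}" "a \<noteq> s"
    "D \<notin> middle_closed n 2" "D \<notin> source_sink n {s} {a}"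
  shows "(indicator (no_dipath s a) D :: real) =
    indicator (closed_event n {s}) D + indicator (closed_event n ({1..n} - {a})) D"
proof -
  have I: "D \<in> no_dipath s a" if "S \<subseteq> {1..n}" "s \<in> S" "a \<notin> S" "D \<in> closed_event n S" for S
    using no_dipath_iff[OF assms(1-3)] that by blast
  have "D \<in> no_dipath s a \<longleftrightarrow> D \<in> closed_event n {s} \<or> D \<in> closed_event n ({1..n} - {a})"
  proof
    assume "D \<in> no_dipath s a"
    then obtain S where S: "S \<subseteq> {1..n}" "s \<in> S" "a \<notin> S" "D \<in> closed_event n S"
      using no_dipath_iff[OF assms(1-3)] by blast
    have fin: "finite S" using S finite_subset by blast
    have "card ({1..n} - S) = n - card S" using S by (simp add: card_Diff_subset fin)
    moreover have "card S \<le> n" using card_mono[OF _ S(1)] by simp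
    moreover have "\<not> (2 \<le> card S \<and> card S + 2 \<le> n)"
      using assms(5) S unfolding middle_closed_def by blast
    ultimately consider "card S \<le> 1" | "card ({1..n} - S) \<le> 1" by linarith
    then show "D \<in> closed_event n {s} \<or> D \<in> closed_event n ({1..n} - {a})"
    proof cases
      case 1
      then have "S = {s}" using S(2) fin by (auto simp: card_le_Suc0_iff_eq)
      then show ?thesis using S by simp
    next
      case 2
      then have "{1..n} - S = {a}" using S assms(3) by (auto simp: card_le_Suc0_iff_eq)
      then have "S = {1..n} - {a}" using S(1) by blast
      then show ?thesis using S by simp
    qed
  next
    assume "D \<in> closed_event n {s} \<or> D \<in> closed_event n ({1..n} - {a})"
    then show "D \<in> no_dipath s a"
    proof
      assume "D \<in> closed_event n {s}"
      then show ?thesis using I[of "{s}"] assms(2-4) by simp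
    next
      assume "D \<in> closed_event n ({1..n} - {a})"
      then show ?thesis using I[of "{1..n} - {a}"] assms(2-4) by simp
    qed
  qed
  then show ?thesis using assms(6) by (auto simp: source_sink_def indicator_def)
qed

lemma of_bool_disjoint_disj4:
  assumes "X \<longleftrightarrow> P \<or> Q \<or> R \<or> S"
    and "\<not> (P \<and> Q)" "\<not> (P \<and> R)" "\<not> (P \<and> S)" "\<not> (Q \<and> R)" "\<not> (Q \<and> S)" "\<not> (R \<and> S)"
  shows "(of_bool X :: real) = of_bool P + of_bool Q + of_bool R + of_bool S"
  using assms by auto

text \<open>The vertex sets that no arc leaves form a lattice. If \<open>S\<close> and \<open>T\<close> witness the two events and both
  are small, then \<open>S \<union> T\<close> is small and contains \<open>s\<close> and \<open>t\<close>, hence equals \<open>{s, t}\<close>; here the edge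
  between \<open>s\<close> and \<open>t\<close> is unrestricted, which makes the events positively correlated. Complements of small
  sets are treated dually with \<open>S \<inter> T\<close>.\<close>

lemma no_dipath_Int_eq_indicator:
  assumes "valid_dgraph n D" "{a, s, b, t} \<subseteq> {1..n}" "distinct [a, s, b, t]" "8 \<le> n"
    "D \<notin> middle_closed n 3" "D \<notin> large_source_sink n"
  shows "(indicator (no_dipath s a \<inter> no_dipath t b) D :: real) =
    indicator (closed_event n {s, t}) D + indicator (closed_event n ({1..n} - {a, b})) D
    + indicator (source_sink n {s} {b}) D + indicator (source_sink n {t} {a}) D"
proof -
  let ?V = "{1..n}"
  let ?E1 = "D \<in> closed_event n {s, t}" and ?E2 = "D \<in> closed_event n (?V - {a, b})"
    and ?E3 = "D \<in> source_sink n {s} {b}" and ?E4 = "D \<in> source_sink n {t} {a}"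
  have in_V: "a \<in> ?V" "s \<in> ?V" "b \<in> ?V" "t \<in> ?V" using assms(2) by auto
  have neq: "a \<noteq> s" "a \<noteq> b" "a \<noteq> t" "s \<noteq> b" "s \<noteq> t" "b \<noteq> t" using assms(3) by auto
  note iffA = no_dipath_iff[OF assms(1) in_V(2,1)] and iffB = no_dipath_iff[OF assms(1) in_V(4,3)]
  note lssI = large_source_sinkI[where D = D and n = n]
  have A: "D \<in> no_dipath s a" if "S \<subseteq> ?V" "s \<in> S" "a \<notin> S" "D \<in> closed_event n S" for S
    using iffA that by blast
  have B: "D \<in> no_dipath t b" if "S \<subseteq> ?V" "t \<in> S" "b \<notin> S" "D \<in> closed_event n S" for S
    using iffB that by blast
  \<comment> \<open>The source of all disjointness below: a small closed set and a small co-closed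
    set with at least three vertices together put \<open>D\<close> into
    \<open>large_source_sink n\<close>.\<close>
  have no: "\<not> (D \<in> closed_event n {x, y} \<and> D \<in> closed_event n (?V - {x', y'}))"
    if "{x, y, x', y'} \<subseteq> ?V" "x \<noteq> y \<or> x' \<noteq> y'" for x y x' y'
    using lssI[OF _ refl refl that] assms(6) unfolding source_sink_def by blast
  have no1: "\<not> (D \<in> closed_event n {x, y} \<and> D \<in> closed_event n (?V - {z}))"
    if "x \<in> ?V" "y \<in> ?V" "z \<in> ?V" "x \<noteq> y" for x y z
    using no[of x y z z] that by simp
  have no2: "\<not> (D \<in> closed_event n {z} \<and> D \<in> closed_event n (?V - {x, y}))"
    if "x \<in> ?V" "y \<in> ?V" "z \<in> ?V" "x \<noteq> y" for x y z
    using no[of z z x y] that by simp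
  have mid: "\<not> (3 \<le> card S \<and> card S + 3 \<le> n)" if "S \<subseteq> ?V" "D \<in> closed_event n S" for S
    using assms(5) that unfolding middle_closed_def by blast
  have compl: "card (?V - S) = n - card S" "card S \<le> n" "finite S" if "S \<subseteq> ?V" for S
  proof -
    show fin: "finite S" using that finite_subset by blast
    show "card (?V - S) = n - card S" using that by (simp add: card_Diff_subset fin)
    show "card S \<le> n" using card_mono[OF _ that] by simp
  qed
  \<comment> \<open>The small set and the small complement are \<open>{u, x}\<close> and
    \<open>{v, y}\<close>; as \<open>large_source_sink\<close> is excluded, x = u and y = v.\<close>
  have mixed: "D \<in> source_sink n {u} {v}"
    if S: "S \<subseteq> ?V" "u \<in> S" "D \<in> closed_event n S" "card S \<le> 2"
      and T: "T \<subseteq> ?V" "v \<in> ?V - T" "D \<in> closed_event n T" "card (?V - T) \<le> 2" for u v S T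
  proof -
    obtain x where x: "S = {u, x}" using card_le_2_cases[OF S(4,2)] compl(3)[OF S(1)] by blast
    obtain y where y: "?V - T = {v, y}" using card_le_2_cases[OF T(4,2)] by blast
    have T': "T = ?V - {v, y}" using y T(1) by blast
    have D: "D \<in> source_sink n {u, x} {v, y}" using S(3) T(3) x T' by (simp add: source_sink_def)
    have sub: "{u, x, v, y} \<subseteq> ?V" using x y S(1) by blast
    have "\<not> (u \<noteq> x \<or> v \<noteq> y)" using lssI[OF D refl refl sub] assms(6) by blast
    then show ?thesis using D by simp
  qed
  have iff: "D \<in> no_dipath s a \<inter> no_dipath t b \<longleftrightarrow> ?E1 \<or> ?E2 \<or> ?E3 \<or> ?E4"
  proof
    assume "D \<in> no_dipath s a \<inter> no_dipath t b"
    then obtain S T where S: "S \<subseteq> ?V" "s \<in> S" "a \<notin> S" "D \<in> closed_event n S"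
      and T: "T \<subseteq> ?V" "t \<in> T" "b \<notin> T" "D \<in> closed_event n T"
      unfolding Int_iff iffA iffB by blast
    have "card S \<le> 2 \<or> card (?V - S) \<le> 2" using mid[OF S(1,4)] compl[OF S(1)] by linarith
    moreover have "card T \<le> 2 \<or> card (?V - T) \<le> 2" using mid[OF T(1,4)] compl[OF T(1)] by linarith
    ultimately consider "card S \<le> 2" "card T \<le> 2" | "card (?V - S) \<le> 2" "card (?V - T) \<le> 2"
      | "card S \<le> 2" "card (?V - T) \<le> 2" | "card (?V - S) \<le> 2" "card T \<le> 2" by blast
    then show "?E1 \<or> ?E2 \<or> ?E3 \<or> ?E4"
    proof cases
      case 1
      have "card (S \<union> T) \<le> 4" using card_Un_le[of S T] 1 by linarith
      \<comment> \<open>Sizes 3 and 4 lie in the excluded middle range because 8 \<le> n.\<close>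
      then have "card (S \<union> T) \<le> 2"
        using mid[OF _ closed_event_Un[OF S(4) T(4)]] S(1) T(1) assms(4) by fastforce
      then obtain x where "S \<union> T = {s, x}"
        using card_le_2_cases[of "S \<union> T" s] S(1,2) T(1) compl(3) by (metis UnI1 finite_UnI)
      moreover have "t \<in> S \<union> T" using T by simp
      ultimately have "S \<union> T = {s, t}" using neq by auto
      then show ?thesis using closed_event_Un[OF S(4) T(4)] by simp
    next
      case 2
      have eq: "?V - S \<inter> T = (?V - S) \<union> (?V - T)" by blast
      have "card (?V - S \<inter> T) \<le> 4"
        unfolding eq using card_Un_le[of "?V - S" "?V - T"] 2 by linarith
      moreover have "S \<inter> T \<subseteq> ?V" using S by blast
      ultimately have "card (?V - S \<inter> T) \<le> 2"
        using mid[OF _ closed_event_Int[OF S(4) T(4)]] compl[of "S \<inter> T"] assms(4) by linarith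
      then obtain x where "?V - S \<inter> T = {a, x}"
        using card_le_2_cases[of "?V - S \<inter> T" a] S(3) in_V(1) by blast
      moreover have "b \<in> ?V - S \<inter> T" using T in_V by blast
      ultimately have "?V - S \<inter> T = {a, b}" using neq by auto
      then have "S \<inter> T = ?V - {a, b}" using S(1) by blast
      then show ?thesis using closed_event_Int[OF S(4) T(4)] by simp
    next
      case 3
      then show ?thesis using mixed[of S s T b] S T in_V by blast
    next
      case 4
      then show ?thesis using mixed[of T t S a] S T in_V by blast
    qed
  next
    assume "?E1 \<or> ?E2 \<or> ?E3 \<or> ?E4"
    then consider ?E1 | ?E2 | ?E3 | ?E4 by blast
    then show "D \<in> no_dipath s a \<inter> no_dipath t b"
    proof cases
      case 1
      then show ?thesis using A[of "{s, t}"] B[of "{s, t}"] in_V neq by simp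
    next
      case 2
      then show ?thesis using A[of "?V - {a, b}"] B[of "?V - {a, b}"] in_V neq by simp
    next
      case 3
      then show ?thesis using A[of "{s}"] B[of "?V - {b}"] in_V neq by (simp add: source_sink_def)
    next
      case 4
      then show ?thesis using A[of "?V - {a}"] B[of "{t}"] in_V neq by (simp add: source_sink_def)
    qed
  qed
  have n1: "\<not> (?E1 \<and> ?E2)" by (rule no) (use in_V neq in auto)
  have n2: "\<not> (?E1 \<and> ?E3)" "\<not> (?E1 \<and> ?E4)"
    using no1[of s t b] no1[of s t a] in_V neq unfolding source_sink_def by blast+
  have n3: "\<not> (?E2 \<and> ?E3)" "\<not> (?E2 \<and> ?E4)"
    using no2[of a b s] no2[of a b t] in_V neq unfolding source_sink_def by blast+
  \<comment> \<open>Both together would close \<open>{s, t}\<close> as a union while no arc enters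
    \<open>b\<close>, which again involves three vertices.\<close>
  have n4: "\<not> (?E3 \<and> ?E4)"
    using no1[of s t b] closed_event_Un[of D n "{s}" "{t}", folded insert_is_Un] in_V neq
    unfolding source_sink_def by blast
  show ?thesis
    unfolding indicator_def by (rule of_bool_disjoint_disj4[OF iff n1 n2 n3 n4])
qed

section \<open>Main terms and error bounds\<close>

lemma integrable_measure_pmf_indicator [simp]:
  "integrable (measure_pmf M) (indicator A :: 'a \<Rightarrow> real)"
  by (intro measure_pmf.integrable_const_bound[of _ 1]) (auto simp: indicator_def)

text \<open>Off \<open>B\<close> the two integrands agree, and on \<open>B\<close> both lie between
  0 and \<open>c\<close>, so they differ by at most \<open>c\<close>.\<close>

lemma prob_approx:
  fixes M :: "'a pmf" and g :: "'a \<Rightarrow> real"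
  assumes "\<And>x. x \<in> set_pmf M \<Longrightarrow> x \<notin> B \<Longrightarrow> indicator A x = g x"
    and "\<And>x. 0 \<le> g x \<and> g x \<le> c" "1 \<le> c" "integrable (measure_pmf M) g"
  shows "\<bar>measure_pmf.prob M A - measure_pmf.expectation M g\<bar> \<le> c * measure_pmf.prob M B"
proof -
  have "measure_pmf.prob M A - measure_pmf.expectation M g = measure_pmf.expectation M (\<lambda>x. indicator A x - g x)"
    using assms(4) by simp
  also have "\<bar>\<dots>\<bar> \<le> measure_pmf.expectation M (\<lambda>x. \<bar>indicator A x - g x\<bar>)"
    by (rule integral_abs_bound)
  also have "\<dots> \<le> measure_pmf.expectation M (\<lambda>x. c * indicator B x)"
  proof (rule integral_mono_AE)
    show "AE x in M. \<bar>indicator A x - g x\<bar> \<le> c * indicator B x"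
    proof (rule AE_pmfI)
      fix x assume "x \<in> set_pmf M"
      then show "\<bar>indicator A x - g x\<bar> \<le> c * indicator B x"
        using assms(1)[of x] assms(2)[of x] assms(3) by (cases "x \<in> B"; cases "x \<in> A") auto
    qed
  qed (use assms(4) in auto)
  finally show ?thesis by simp
qed

lemma card_times_Diff:
  assumes "S \<subseteq> {1..n}"
  shows "card (S \<times> ({1..n} - S)) = card S * (n - card S)"
  using assms finite_subset[OF assms] by (simp add: card_cartesian_product card_Diff_subset)

lemma Times_Diff_subset_arc_set: "S \<subseteq> {1..n} \<Longrightarrow> S \<times> ({1..n} - S) \<subseteq> arc_set n"
  unfolding arc_set_def by auto

definition source_sink_arcs :: "nat \<Rightarrow> nat set \<Rightarrow> nat set \<Rightarrow> (nat \<times> nat) set" where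
  "source_sink_arcs n S T = S \<times> ({1..n} - S) \<union> ({1..n} - T) \<times> T"

lemma source_sink_arcs_subset: "S \<subseteq> {1..n} \<Longrightarrow> T \<subseteq> {1..n} \<Longrightarrow> source_sink_arcs n S T \<subseteq> arc_set n"
  unfolding arc_set_def source_sink_arcs_def by auto

lemma source_sink_eq:
  "T \<subseteq> {1..n} \<Longrightarrow> source_sink n S T = avoiding (source_sink_arcs n S T)"
  by (simp add: source_sink_def closed_event_def source_sink_arcs_def avoiding_Un double_diff)

text \<open>An arc counted twice leaves \<open>S\<close> and enters \<open>T\<close>, so it lies in
  \<open>S \<times> T\<close>. The overlap stands on the right to avoid truncated
  subtraction.\<close>

lemma card_source_sink_arcs:
  assumes "S \<subseteq> {1..n}" "T \<subseteq> {1..n}"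
  shows "card S * (n - card S) + card T * (n - card T) \<le> card (source_sink_arcs n S T) + card S * card T"
proof -
  let ?F = "S \<times> ({1..n} - S)" and ?G = "({1..n} - T) \<times> T"
  have fin: "finite S" "finite T" using assms finite_subset by blast+
  have "card (?F \<inter> ?G) \<le> card (S \<times> T)" using fin by (intro card_mono) auto
  moreover have "card ?F + card ?G = card (?F \<union> ?G) + card (?F \<inter> ?G)"
    using fin by (intro card_Un_Int) auto
  moreover have "card ?G = card T * (n - card T)"
    using assms fin by (simp add: card_cartesian_product card_Diff_subset)
  ultimately show ?thesis
    using card_times_Diff[OF assms(1)] card_cartesian_product[of S T]
    unfolding source_sink_arcs_def by linarith
qed

section \<open>Bounds for fixed \<open>n\<close> and \<open>m\<close>, with \<open>q\<close> built
  from the exact edge density\<close>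

context
  fixes n m :: nat and q :: real
  assumes n: "2 \<le> n" and m: "m \<le> n choose 2"
  defines "q \<equiv> 1 - real m / real (n choose 2) / 2"
begin

lemma q_bounds: "1 / 2 \<le> q" "q \<le> 1"
  using n m by (auto simp: q_def divide_le_eq)

lemma prob_middle_closed_le:
  "measure_pmf.prob (random_dgraph n m) (middle_closed n j) \<le>
    real ((n choose 2) + 1) * (\<Sum>k=j..n-j. real (n choose k) * q ^ (k * (n - k)))"
proof -
  let ?P = "measure_pmf.prob (random_dgraph n m)"
  let ?S = "\<lambda>k. {S. S \<subseteq> {1..n} \<and> card S = k}"
  have fin: "finite (?S k)" for k by (rule finite_subset[of _ "Pow {1..n}"]) auto
  have "?P (middle_closed n j) \<le> ?P (\<Union>k\<in>{j..n-j}. \<Union>S\<in>?S k. closed_event n S)"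
  proof (intro measure_pmf.finite_measure_mono subsetI)
    fix D assume "D \<in> middle_closed n j"
    then obtain S where "S \<subseteq> {1..n}" "j \<le> card S" "card S + j \<le> n" "D \<in> closed_event n S"
      by (auto simp: middle_closed_def)
    then show "D \<in> (\<Union>k\<in>{j..n-j}. \<Union>S\<in>?S k. closed_event n S)"
      by (intro UN_I[of "card S"] UN_I[of S]) auto
  qed simp
  also have "\<dots> \<le> (\<Sum>k=j..n-j. ?P (\<Union>S\<in>?S k. closed_event n S))"
    by (rule measure_UNION_le) auto
  also have "\<dots> \<le> (\<Sum>k=j..n-j. \<Sum>S\<in>?S k. ?P (closed_event n S))"
    by (intro sum_mono measure_UNION_le fin) auto
  also have "\<dots> \<le> (\<Sum>k=j..n-j. \<Sum>S\<in>?S k. real ((n choose 2) + 1) * q ^ (k * (n - k)))"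
  proof (intro sum_mono)
    fix k S assume "S \<in> ?S k"
    then have S: "S \<subseteq> {1..n}" "card S = k" by auto
    show "?P (closed_event n S) \<le> real ((n choose 2) + 1) * q ^ (k * (n - k))"
      using prob_avoiding_le[OF Times_Diff_subset_arc_set[OF S(1)] m n] S
      by (simp only: closed_event_def card_times_Diff q_def)
  qed
  also have "\<dots> = (\<Sum>k=j..n-j. real ((n choose 2) + 1) * (real (n choose k) * q ^ (k * (n - k))))"
    using n_subsets[of "{1..n}"] by (simp add: ac_simps)
  finally show ?thesis by (simp only: sum_distrib_left)
qed

lemma prob_source_sink_le:
  assumes "S \<subseteq> {1..n}" "T \<subseteq> {1..n}" "l + card S * card T \<le> card S * (n - card S) + card T * (n - card T)"
  shows "measure_pmf.prob (random_dgraph n m) (source_sink n S T) \<le> real ((n choose 2) + 1) * q ^ l"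
proof -
  have "measure_pmf.prob (random_dgraph n m) (source_sink n S T) \<le>
      real ((n choose 2) + 1) * q ^ card (source_sink_arcs n S T)"
    unfolding source_sink_eq[OF assms(2)] q_def
    by (intro prob_avoiding_le source_sink_arcs_subset assms m n)
  also have "\<dots> \<le> real ((n choose 2) + 1) * q ^ l"
    using card_source_sink_arcs[OF assms(1,2)] assms(3) q_bounds
    by (intro mult_left_mono power_decreasing) auto
  finally show ?thesis .
qed

lemma prob_large_source_sink_le:
  assumes "3 \<le> n"
  shows "measure_pmf.prob (random_dgraph n m) (large_source_sink n) \<le>
    real ((n choose 2) + 1) * real n ^ 4 * q ^ (3 * n - 9)"
proof -
  let ?P = "measure_pmf.prob (random_dgraph n m)" and ?V = "{1..n}"
  let ?I = "{(x, y, x', y'). {x, y, x', y'} \<subseteq> ?V \<and> 3 \<le> card {x, y} + card {x', y'}}"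
  \<comment> \<open>Sizes 1 and 2 leave 3n - 7 arcs after removing the overlap, sizes 2 and 2 leave
    4n - 12; both are at least 3n - 9 when 3 \<le> n.\<close>
  have arith: "3 * n - 9 + i * j \<le> i * (n - i) + j * (n - j)"
    if "i = 1 \<or> i = 2" "j = 1 \<or> j = 2" "3 \<le> i + j" for i j :: nat
    using that assms by auto
  have sub: "?I \<subseteq> ?V \<times> ?V \<times> ?V \<times> ?V" by auto
  then have fin: "finite ?I" by (rule finite_subset) simp
  have "?P (large_source_sink n) \<le> (\<Sum>(x, y, x', y')\<in>?I. ?P (source_sink n {x, y} {x', y'}))"
    unfolding large_source_sink_def using measure_UNION_le[OF fin, of "\<lambda>(x, y, x', y'). source_sink n {x, y} {x', y'}"]
    by (simp add: case_prod_unfold)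
  also have "\<dots> \<le> (\<Sum>_\<in>?I. real ((n choose 2) + 1) * q ^ (3 * n - 9))"
  proof (rule sum_mono, clarify)
    fix x y x' y' assume V: "{x, y, x', y'} \<subseteq> ?V" and c: "3 \<le> card {x, y} + card {x', y'}"
    have "card {x, y} = 1 \<or> card {x, y} = 2" by (cases "x = y") simp_all
    moreover have "card {x', y'} = 1 \<or> card {x', y'} = 2" by (cases "x' = y'") simp_all
    ultimately have "3 * n - 9 + card {x, y} * card {x', y'} \<le>
        card {x, y} * (n - card {x, y}) + card {x', y'} * (n - card {x', y'})"
      using c by (intro arith)
    then show "?P (source_sink n {x, y} {x', y'}) \<le> real ((n choose 2) + 1) * q ^ (3 * n - 9)"
      using V by (intro prob_source_sink_le) auto
  qed
  also have "\<dots> = real (card ?I) * (real ((n choose 2) + 1) * q ^ (3 * n - 9))" by simp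
  also have "\<dots> \<le> real n ^ 4 * (real ((n choose 2) + 1) * q ^ (3 * n - 9))"
  proof (rule mult_right_mono)
    have "card ?I \<le> card (?V \<times> ?V \<times> ?V \<times> ?V)" using sub by (rule card_mono[rotated]) simp
    also have "\<dots> = n ^ 4" by (simp add: card_cartesian_product power_numeral_reduce)
    finally have "real (card ?I) \<le> real (n ^ 4)" by (rule of_nat_mono)
    then show "real (card ?I) \<le> real n ^ 4" by (simp only: of_nat_power)
    show "0 \<le> real ((n choose 2) + 1) * q ^ (3 * n - 9)" using q_bounds by simp
  qed
  finally show ?thesis by (simp only: ac_simps)
qed

lemma prob_closed_event:
  assumes "S \<subseteq> {1..n}"
  shows "measure_pmf.prob (random_dgraph n m) (closed_event n S) =
    half_prob (n choose 2) m (card S * (n - card S))"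
  using prob_avoiding_eq[OF Times_Diff_subset_arc_set[OF assms] m] card_times_Diff[OF assms]
  by (auto simp: closed_event_def antisym_def)

text \<open>The arc from \<open>u\<close> to \<open>v\<close> both leaves the source and enters the
  sink, so 2(n - 1) counts it twice.\<close>

lemma prob_source_sink_singletons:
  assumes "u \<in> {1..n}" "v \<in> {1..n}" "u \<noteq> v"
  shows "measure_pmf.prob (random_dgraph n m) (source_sink n {u} {v}) = half_prob (n choose 2) m (2 * n - 3)"
proof -
  let ?F = "{u} \<times> ({1..n} - {u})" and ?G = "({1..n} - {v}) \<times> {v}"
  have F: "source_sink_arcs n {u} {v} = ?F \<union> ?G" by (simp add: source_sink_arcs_def)
  have "antisym (source_sink_arcs n {u} {v})"
    using assms(3) by (auto simp: source_sink_arcs_def antisym_def)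
  moreover have "card (source_sink_arcs n {u} {v}) = 2 * n - 3"
  proof -
    have "?F \<inter> ?G = {(u, v)}" using assms by auto
    moreover have "card ?F + card ?G = card (?F \<union> ?G) + card (?F \<inter> ?G)"
      by (intro card_Un_Int) auto
    moreover have "card ?F = n - 1" "card ?G = n - 1"
      using assms by (simp_all add: card_cartesian_product)
    ultimately show ?thesis unfolding F using n by simp
  qed
  ultimately show ?thesis
    using assms prob_avoiding_eq[OF source_sink_arcs_subset m, of "{u}" "{v}"] by (simp add: source_sink_eq)
qed

lemma prob_no_dipath_approx:
  assumes "s \<in> {1..n}" "a \<in> {1..n}" "a \<noteq> s"
  shows "\<bar>measure_pmf.prob (random_dgraph n m) (no_dipath s a) - 2 * half_prob (n choose 2) m (n - 1)\<bar> \<le>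
    2 * real ((n choose 2) + 1) * ((\<Sum>k=2..n-2. real (n choose k) * q ^ (k * (n - k))) + q ^ (2 * n - 3))"
proof -
  let ?M = "random_dgraph n m"
  let ?P = "measure_pmf.prob ?M"
  let ?g = "\<lambda>D. indicator (closed_event n {s}) D + indicator (closed_event n ({1..n} - {a})) D :: real"
  let ?B = "middle_closed n 2 \<union> source_sink n {s} {a}"
  have "\<bar>?P (no_dipath s a) - measure_pmf.expectation ?M ?g\<bar> \<le> 2 * ?P ?B"
  proof (rule prob_approx)
    show "indicator (no_dipath s a) D = ?g D" if "D \<in> set_pmf ?M" "D \<notin> ?B" for D
      using that assms by (intro no_dipath_eq_indicator valid_random_dgraph[OF m]) auto
    show "0 \<le> ?g D \<and> ?g D \<le> 2" for D by (auto simp: indicator_def)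
  qed (simp_all add: integrable_add)
  also have "measure_pmf.expectation ?M ?g = ?P (closed_event n {s}) + ?P (closed_event n ({1..n} - {a}))"
    by simp
  also have "\<dots> = 2 * half_prob (n choose 2) m (n - 1)"
    using assms n by (simp add: prob_closed_event card_Diff_subset)
  also have "?P ?B \<le> ?P (middle_closed n 2) + ?P (source_sink n {s} {a})"
    by (rule measure_Un_le) auto
  also have "\<dots> \<le> real ((n choose 2) + 1) * (\<Sum>k=2..n-2. real (n choose k) * q ^ (k * (n - k)))
      + real ((n choose 2) + 1) * q ^ (2 * n - 3)"
    using assms n by (intro add_mono[OF prob_middle_closed_le prob_source_sink_le]) auto
  finally show ?thesis by (simp add: algebra_simps)
qed

lemma prob_no_dipath_Int_approx:
  assumes "{a, s, b, t} \<subseteq> {1..n}" "distinct [a, s, b, t]" "8 \<le> n"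
  shows "\<bar>measure_pmf.prob (random_dgraph n m) (no_dipath s a \<inter> no_dipath t b)
      - 2 * (half_prob (n choose 2) m (2 * n - 4) + half_prob (n choose 2) m (2 * n - 3))\<bar> \<le>
    4 * real ((n choose 2) + 1) * ((\<Sum>k=3..n-3. real (n choose k) * q ^ (k * (n - k))) + real n ^ 4 * q ^ (3 * n - 9))"
proof -
  let ?M = "random_dgraph n m"
  let ?P = "measure_pmf.prob ?M"
  let ?g = "\<lambda>D. indicator (closed_event n {s, t}) D + indicator (closed_event n ({1..n} - {a, b})) D
    + indicator (source_sink n {s} {b}) D + indicator (source_sink n {t} {a}) D :: real"
  let ?B = "middle_closed n 3 \<union> large_source_sink n"
  have "\<bar>?P (no_dipath s a \<inter> no_dipath t b) - measure_pmf.expectation ?M ?g\<bar> \<le> 4 * ?P ?B"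
  proof (rule prob_approx)
    show "indicator (no_dipath s a \<inter> no_dipath t b) D = ?g D" if "D \<in> set_pmf ?M" "D \<notin> ?B" for D
      using that assms by (intro no_dipath_Int_eq_indicator valid_random_dgraph[OF m]) auto
    show "0 \<le> ?g D \<and> ?g D \<le> 4" for D by (auto simp: indicator_def)
  qed (simp_all add: integrable_add)
  also have "measure_pmf.expectation ?M ?g = ?P (closed_event n {s, t}) + ?P (closed_event n ({1..n} - {a, b}))
      + ?P (source_sink n {s} {b}) + ?P (source_sink n {t} {a})"
    by simp
  also have "\<dots> = 2 * (half_prob (n choose 2) m (2 * n - 4) + half_prob (n choose 2) m (2 * n - 3))"
  proof -
    have "card {s, t} = 2" "card ({1..n} - {a, b}) = n - 2"
      using assms by (simp_all add: card_Diff_subset)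
    moreover have "n - (n - 2) = 2" "2 * (n - 2) = 2 * n - 4" "(n - 2) * 2 = 2 * n - 4" using n by auto
    moreover have "{s, t} \<subseteq> {1..n}" "{1..n} - {a, b} \<subseteq> {1..n}" using assms by auto
    ultimately have "?P (closed_event n {s, t}) = half_prob (n choose 2) m (2 * n - 4)"
      "?P (closed_event n ({1..n} - {a, b})) = half_prob (n choose 2) m (2 * n - 4)"
      by (simp_all only: prob_closed_event)
    moreover have "?P (source_sink n {s} {b}) = half_prob (n choose 2) m (2 * n - 3)"
      "?P (source_sink n {t} {a}) = half_prob (n choose 2) m (2 * n - 3)"
      using assms by (intro prob_source_sink_singletons; auto)+
    ultimately show ?thesis by simp
  qed
  also have "?P ?B \<le> ?P (middle_closed n 3) + ?P (large_source_sink n)"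
    by (rule measure_Un_le) auto
  also have "\<dots> \<le> real ((n choose 2) + 1) * (\<Sum>k=3..n-3. real (n choose k) * q ^ (k * (n - k)))
      + real ((n choose 2) + 1) * real n ^ 4 * q ^ (3 * n - 9)"
    using assms by (intro add_mono[OF prob_middle_closed_le prob_large_source_sink_le]) auto
  finally show ?thesis by (simp add: algebra_simps)
qed

end

section \<open>Successive ratios of the main terms\<close>

definition half_ratio :: "nat \<Rightarrow> nat \<Rightarrow> nat \<Rightarrow> real" where
  "half_ratio N m K = half_prob N m (Suc K) / half_prob N m K"

lemma half_prob_0: "m \<le> N \<Longrightarrow> half_prob N m 0 = 1"
  by (simp add: half_prob_def half_esym_0)

lemma half_prob_pos: "m \<le> N \<Longrightarrow> K \<le> N \<Longrightarrow> half_prob N m K > 0"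
  by (simp add: half_prob_def half_esym_pos)

lemma half_prob_Suc: "m \<le> N \<Longrightarrow> K \<le> N \<Longrightarrow> half_prob N m (Suc K) = half_prob N m K * half_ratio N m K"
  using half_prob_pos[of m N K] by (simp add: half_ratio_def)

lemma half_prob_add:
  assumes "m \<le> N" "L + K \<le> N"
  shows "half_prob N m (L + K) = half_prob N m L * (\<Prod>i<K. half_ratio N m (L + i))"
  using assms(2)
proof (induction K)
  case (Suc K)
  then show ?case using half_prob_Suc[OF assms(1), of "L + K"] by simp
qed simp

lemma half_ratio_bounds:
  assumes "m \<le> N" "K < N"
  shows "1 / 2 \<le> half_ratio N m K" "half_ratio N m K \<le> 1"
  using half_esym_step[OF assms(2), of m] half_esym_pos[of m N K] assms
  by (simp_all add: half_ratio_def half_prob_def field_simps)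

text \<open>Dividing the three-term recurrence by its middle term leaves a first-order one, here
  centred at \<open>1 - p / 2\<close>, the ratio for independent edges of density \<open>p\<close>.
  At K = 0 the truncated index \<open>K - 1\<close> is harmless, being multiplied by K.\<close>

lemma half_ratio_recurrence:
  assumes "m \<le> N" "K < N"
  shows "(real N - real K) * (half_ratio N m K - (1 - p / 2)) =
    (p * real N - real m) / 2 + real K * (1 / (2 * half_ratio N m (K - 1)) + (1 - p / 2) - 3 / 2)"
proof -
  have C: "real (N choose m) > 0" using assms by simp
  have pos: "half_esym N m K > 0" using half_esym_pos assms by simp
  have r: "half_ratio N m K = half_esym N m (Suc K) / half_esym N m K"
    using C by (simp add: half_ratio_def half_prob_def)
  show ?thesis
  proof (cases "K = 0")
    case True
    then have "real N * half_ratio N m K = real N * half_esym N m 1 / half_esym N m 0"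
      using r unfolding True by simp
    also have "\<dots> = real N - real m / 2" using half_esym_1[of N m] assms pos True by simp
    finally show ?thesis using True by (simp add: algebra_simps diff_divide_distrib)
  next
    case False
    then have "half_ratio N m (K - 1) = half_esym N m K / half_esym N m (K - 1)"
      using C by (simp add: half_ratio_def half_prob_def)
    then have r': "1 / half_ratio N m (K - 1) = half_esym N m (K - 1) / half_esym N m K" by simp
    have "(real N - real K) * half_ratio N m K = (real (N - K) * half_esym N m (Suc K)) / half_esym N m K"
      using assms by (simp add: r)
    also have "\<dots> = real N - 3 / 2 * real K - real m / 2 + real K / 2 * (1 / half_ratio N m (K - 1))"
      unfolding r' using half_esym_recurrence[of K N m] False assms pos by (simp add: add_divide_distrib)
    finally show ?thesis by (simp add: algebra_simps add_divide_distrib diff_divide_distrib)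
  qed
qed

lemma abs_le_divide:
  fixes x y a b :: real
  assumes "0 < b" "b \<le> y" "\<bar>y * x\<bar> \<le> a"
  shows "\<bar>x\<bar> \<le> a / b"
proof -
  have "b * \<bar>x\<bar> \<le> y * \<bar>x\<bar>" using assms by (intro mult_right_mono) auto
  also have "\<dots> = \<bar>y * x\<bar>" using assms by (simp add: abs_mult)
  finally show ?thesis using assms by (simp add: field_simps)
qed

section \<open>Ratios up to O(1/n^2) for K \<le> 2n, with \<open>q\<close> now built from the
  limiting density\<close>

context
  fixes p :: real and n m :: nat and N :: nat and q \<kappa> :: real and r :: "nat \<Rightarrow> real"
  assumes p: "0 < p" "p < 1" and n: "10 \<le> n"
    and m: "real m \<le> p * real (n choose 2)" "p * real (n choose 2) \<le> real m + 1"
  defines "N \<equiv> n choose 2"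
    and "q \<equiv> 1 - p / 2" and "\<kappa> \<equiv> p * (1 - p) / (2 * (2 - p))" and "r \<equiv> half_ratio N m"
begin

lemma N_eq: "real N = real n * (real n - 1) / 2"
proof -
  have "even (n * (n - 1))" using n by (cases n) auto
  then have "2 * N = n * (n - 1)" unfolding N_def choose_two by (rule dvd_mult_div_cancel)
  then have "real (2 * N) = real (n * (n - 1))" by (rule arg_cong)
  then show ?thesis using n by (simp add: of_nat_diff)
qed

lemma m_le_N: "m \<le> N"
proof -
  have "p * real N \<le> 1 * real N" using p by (intro mult_right_mono) auto
  then have "real m \<le> real N" using m by (simp add: N_def)
  then show ?thesis by simp
qed

text \<open>N - 2n = (n^2 - 5n)/2, which is at least n^2/4 once 10 \<le> n.\<close>

lemma N_minus_ge:
  assumes "K \<le> 2 * n"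
  shows "(real n)\<^sup>2 / 4 \<le> real N - real K" "K < N"
proof -
  have "10 * real n \<le> real n * real n" using n by (intro mult_right_mono) auto
  moreover have "real K \<le> 2 * real n" using assms by linarith
  ultimately show 1: "(real n)\<^sup>2 / 4 \<le> real N - real K"
    by (simp add: N_eq power2_eq_square algebra_simps)
  have "(real n)\<^sup>2 > 0" using n by simp
  then have "real K < real N" using 1 by linarith
  then show "K < N" by simp
qed

lemma q_range: "1 / 2 \<le> q" "q \<le> 1" using p by (auto simp: q_def)

lemma r_range: "K \<le> 2 * n \<Longrightarrow> 1 / 2 \<le> r K" "K \<le> 2 * n \<Longrightarrow> r K \<le> 1"
  using half_ratio_bounds[OF m_le_N] N_minus_ge by (auto simp: r_def)

lemma \<kappa>_range: "0 \<le> \<kappa>" "\<kappa> \<le> 1 / 8"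
proof -
  show "0 \<le> \<kappa>" using p by (simp add: \<kappa>_def)
  have "p * (1 - p) \<le> 1 / 4" using zero_le_power2[of "p - 1/2"] by (simp add: power2_eq_square algebra_simps)
  then show "\<kappa> \<le> 1 / 8" using p by (simp add: \<kappa>_def field_simps)
qed

text \<open>The trivial range of the preceding ratio already bounds the bracket in the recurrence by
  1/2, so the right-hand side is at most 2n; division by n^2/4 gives 8/n.\<close>

lemma r_first_order:
  assumes "K \<le> 2 * n"
  shows "\<bar>r K - q\<bar> \<le> 8 / real n"
proof -
  let ?r = "r (K - 1)"
  have r1: "1 / 2 \<le> ?r" "?r \<le> 1" using r_range assms by auto
  have "1 / (2 * ?r) \<le> 1" "1 / 2 \<le> 1 / (2 * ?r)" using r1 by (auto simp: field_simps)
  then have "\<bar>1 / (2 * ?r) + q - 3 / 2\<bar> \<le> 1 / 2" using q_range by linarith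
  then have "real K * \<bar>1 / (2 * ?r) + q - 3 / 2\<bar> \<le> (2 * real n) * (1 / 2)"
    using assms by (intro mult_mono) auto
  moreover have "\<bar>(p * real N - real m) / 2\<bar> \<le> 1 / 2" using m by (simp add: N_def)
  ultimately have "\<bar>(p * real N - real m) / 2\<bar> + \<bar>real K * (1 / (2 * ?r) + q - 3 / 2)\<bar> \<le> 2 * real n"
    using n by (simp add: abs_mult)
  then have "\<bar>(real N - real K) * (r K - q)\<bar> \<le> 2 * real n"
    unfolding r_def q_def half_ratio_recurrence[OF m_le_N N_minus_ge(2)[OF assms]] by linarith
  then have "\<bar>r K - q\<bar> \<le> 2 * real n / ((real n)\<^sup>2 / 4)"
    using N_minus_ge(1)[OF assms] n by (intro abs_le_divide[of _ "real N - real K"]) auto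
  then show ?thesis using n by (simp add: power2_eq_square field_simps)
qed

text \<open>Replacing the preceding ratio by \<open>q\<close> in the recurrence is now justified by
  the first-order bound: since K \<le> 2n, it changes the right-hand side by at most 32. With 2 for
  the quadratic term in K and 1/2 for rounding, the total stays below 35, and 140 = 4 * 35.\<close>

lemma r_second_order:
  assumes "K \<le> 2 * n"
  shows "\<bar>r K - (q - \<kappa> * real K / real N)\<bar> \<le> 140 / (real n)\<^sup>2"
proof -
  let ?r = "r (K - 1)"
  have N0: "real N > 0" using N_minus_ge[of 0] n by simp
  have r1: "1 / 2 \<le> ?r" "?r \<le> 1" using r_range assms by auto
  \<comment> \<open>\<kappa> is minus the bracket of the recurrence at \<open>q\<close>, that is (1
    - q)(2q - 1)/(2q).\<close>
  have \<kappa>: "1 / (2 * q) + q - 3 / 2 + \<kappa> = 0"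
    using p by (simp add: q_def \<kappa>_def field_simps power2_eq_square)
  have "1 / 2 * (1 / 2) \<le> ?r * q" using r1 q_range by (intro mult_mono) auto
  then have prod: "1 / 4 \<le> ?r * q" by simp
  have "1 / (2 * ?r) - 1 / (2 * q) = (q - ?r) / (2 * (?r * q))"
    using r1 q_range by (simp add: field_simps)
  then have "\<bar>1 / (2 * ?r) - 1 / (2 * q)\<bar> = \<bar>q - ?r\<bar> / (2 * (?r * q))"
    using prod abs_of_pos[of "2 * (?r * q)"] by (simp only: abs_divide)
  also have "\<dots> \<le> (8 / real n) / (2 * (1 / 4))"
    using prod r_first_order[of "K - 1"] order_trans[OF diff_le_self assms] abs_minus_commute[of q ?r]
    by (intro frac_le) auto
  finally have "real K * \<bar>1 / (2 * ?r) - 1 / (2 * q)\<bar> \<le> (2 * real n) * ((8 / real n) / (2 * (1 / 4)))"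
    using assms by (intro mult_mono) auto
  also have "\<dots> = 32" using n by simp
  finally have t1: "\<bar>real K * (1 / (2 * ?r) - 1 / (2 * q))\<bar> \<le> 32" by (simp add: abs_mult)
  have "\<kappa> * (real K)\<^sup>2 / real N \<le> (1 / 8) * (2 * real n)\<^sup>2 / ((real n)\<^sup>2 / 4)"
    using \<kappa>_range assms N_minus_ge(1)[of 0] n by (intro frac_le mult_mono power_mono) auto
  also have "\<dots> = 2" using n by (simp add: power2_eq_square field_simps)
  finally have t2: "\<kappa> * (real K)\<^sup>2 / real N \<le> 2" .
  have t2': "0 \<le> \<kappa> * (real K)\<^sup>2 / real N" using \<kappa>_range by simp
  have t3: "\<bar>(p * real N - real m) / 2\<bar> \<le> 1 / 2" using m by (simp add: N_def)
  have "(real N - real K) * (r K - (q - \<kappa> * real K / real N)) =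
      (real N - real K) * (r K - q) + (real N - real K) * (\<kappa> * real K / real N)"
    by (simp add: algebra_simps)
  also have "(real N - real K) * (\<kappa> * real K / real N) = \<kappa> * real K - \<kappa> * (real K)\<^sup>2 / real N"
    using N0 by (simp add: field_simps power2_eq_square)
  also have "(real N - real K) * (r K - q) = (p * real N - real m) / 2 + real K * (1 / (2 * ?r) + q - 3 / 2)"
    unfolding r_def q_def using half_ratio_recurrence[OF m_le_N N_minus_ge(2)[OF assms]] .
  also have "real K * (1 / (2 * ?r) + q - 3 / 2) = real K * (1 / (2 * ?r) - 1 / (2 * q)) - \<kappa> * real K"
  proof -
    have "1 / (2 * ?r) + q - 3 / 2 = (1 / (2 * ?r) - 1 / (2 * q)) - \<kappa>" using \<kappa> by linarith
    then show ?thesis by (simp only: right_diff_distrib mult.commute[of \<kappa>])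
  qed
  finally have "\<bar>(real N - real K) * (r K - (q - \<kappa> * real K / real N))\<bar> \<le> 35"
    using t1 t2 t2' t3 by linarith
  then have "\<bar>r K - (q - \<kappa> * real K / real N)\<bar> \<le> 35 / ((real n)\<^sup>2 / 4)"
    using N_minus_ge(1)[OF assms] n by (intro abs_le_divide[of _ "real N - real K"]) auto
  then show ?thesis by simp
qed

text \<open>Shifting K by n - 1 moves the linear term by \<kappa>(n - 1)/N = 2\<kappa>/n. The error
  collects 4 from replacing \<open>r K\<close> by \<open>q\<close> and 140 twice from the
  expansions; dividing by r K \<ge> 1/2 doubles 284 to 568.\<close>

lemma r_shift:
  assumes "K < n - 1"
  shows "\<bar>r (n - 1 + K) / r K - (1 - 2 * \<kappa> / q / real n)\<bar> \<le> 568 / (real n)\<^sup>2"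
proof -
  define c where "c = 2 * \<kappa> / q"
  have c: "0 \<le> c" "c \<le> 1 / 2"
    using \<kappa>_range q_range by (auto simp: c_def field_simps)
  have n0: "real n > 0" "real n \<noteq> 1" "real n - 1 > 0" using n by auto
  have rK: "1 / 2 \<le> r K" using r_range assms by auto
  define e1 where "e1 = r (n - 1 + K) - (q - \<kappa> * real (n - 1 + K) / real N)"
  define e2 where "e2 = r K - (q - \<kappa> * real K / real N)"
  have e: "\<bar>e1\<bar> \<le> 140 / (real n)\<^sup>2" "\<bar>e2\<bar> \<le> 140 / (real n)\<^sup>2"
    unfolding e1_def e2_def by (rule r_second_order; use assms in simp)+
  have "(real n - 1) / real N = 2 / real n" using n0 unfolding N_eq by (simp add: divide_simps)
  moreover have "real (n - 1 + K) = real K + (real n - 1)" using n by (simp add: of_nat_diff)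
  ultimately have "\<kappa> * real (n - 1 + K) / real N = \<kappa> * real K / real N + \<kappa> * (2 / real n)"
    by (simp only: distrib_left add_divide_distrib times_divide_eq_right[symmetric])
  also have "\<kappa> * (2 / real n) = c / real n * q" using q_range by (simp add: c_def)
  finally have A: "\<kappa> * real (n - 1 + K) / real N = \<kappa> * real K / real N + c / real n * q" .
  have "x - y * (1 - d) = d * (y - q) + (x - (q - A)) - (y - (q - B))" if "A = B + d * q" for x y d A B
    using that by (simp add: algebra_simps)
  from this[OF A] have eq: "r (n - 1 + K) - r K * (1 - c / real n) = c / real n * (r K - q) + e1 - e2"
    unfolding e1_def e2_def .
  have "\<bar>c / real n * (r K - q)\<bar> \<le> (1 / 2) / real n * (8 / real n)"
    unfolding abs_mult
  proof (intro mult_mono r_first_order)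
    have "c / real n \<le> (1 / 2) / real n" using c by (intro divide_right_mono) auto
    then show "\<bar>c / real n\<bar> \<le> (1 / 2) / real n" using c by simp
  qed (use assms in auto)
  also have "\<dots> = 4 / (real n)\<^sup>2" by (simp add: power2_eq_square)
  finally have "\<bar>c / real n * (r K - q)\<bar> \<le> 4 / (real n)\<^sup>2" .
  moreover have "\<bar>x + y - z\<bar> \<le> a + b + d" if "\<bar>x\<bar> \<le> a" "\<bar>y\<bar> \<le> b" "\<bar>z\<bar> \<le> d"
    for x y z a b d :: real using that by linarith
  ultimately have "\<bar>c / real n * (r K - q) + e1 - e2\<bar> \<le> 4 / (real n)\<^sup>2 + 140 / (real n)\<^sup>2 + 140 / (real n)\<^sup>2"
    using e by blast
  then have "\<bar>r (n - 1 + K) - r K * (1 - c / real n)\<bar> \<le> 284 / (real n)\<^sup>2"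
    unfolding eq by (simp flip: add_divide_distrib)
  moreover have "r (n - 1 + K) - r K * (1 - c / real n) = r K * (r (n - 1 + K) / r K - (1 - c / real n))"
    using rK by (simp add: right_diff_distrib)
  ultimately have "\<bar>r K * (r (n - 1 + K) / r K - (1 - c / real n))\<bar> \<le> 284 / (real n)\<^sup>2" by simp
  from abs_le_divide[OF _ rK this] have "\<bar>r (n - 1 + K) / r K - (1 - c / real n)\<bar> \<le> 284 / (real n)\<^sup>2 / (1 / 2)"
    by simp
  then show ?thesis by (simp add: c_def)
qed

text \<open>As \<open>half_prob N m 0 = 1\<close>, the quotient is a product of n - 1 ratios divided
  by the product of the first n - 1 ratios. Pairing factors at distance n - 1 cancels the leading
  term \<open>q\<close> in each.\<close>

lemma half_prob_double_bounds:
  assumes "30 \<le> n"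
  defines "x \<equiv> half_prob N m (2 * n - 2) / (half_prob N m (n - 1))\<^sup>2"
  shows "(1 - 2 * \<kappa> / q / real n - 568 / (real n)\<^sup>2) ^ (n - 1) \<le> x"
    and "x \<le> (1 - 2 * \<kappa> / q / real n + 568 / (real n)\<^sup>2) ^ (n - 1)"
proof -
  let ?f = "\<lambda>K. r (n - 1 + K) / r K"
  let ?c = "2 * \<kappa> / q / real n"
  have le: "2 * n - 2 \<le> N" using N_minus_ge(2)[of "2 * n - 2"] by simp
  define L where "L = n - 1"
  have L: "n - 1 = L" "2 * n - 2 = L + L" by (simp_all add: L_def)
  have "half_prob N m (L + L) = half_prob N m L * (\<Prod>i<L. r (L + i))"
    unfolding r_def using le L by (intro half_prob_add m_le_N) auto
  moreover have "half_prob N m (0 + L) = half_prob N m 0 * (\<Prod>i<L. r (0 + i))"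
    unfolding r_def using le L by (intro half_prob_add m_le_N) auto
  moreover have "half_prob N m L > 0" using le L by (intro half_prob_pos m_le_N) auto
  ultimately have "x = (\<Prod>i<n-1. r (n - 1 + i)) / (\<Prod>i<n-1. r i)"
    unfolding x_def L by (simp add: half_prob_0[OF m_le_N] power2_eq_square)
  then have x: "x = (\<Prod>i<n-1. ?f i)" by (simp add: prod_dividef)
  have "?c \<le> 1 / 4"
  proof -
    have "2 * \<kappa> / q \<le> 1 / 2" using \<kappa>_range q_range by (auto simp: field_simps)
    then have "?c \<le> (1 / 2) / 30" using assms(1) by (intro frac_le[of "1 / 2"]) auto
    then show ?thesis by simp
  qed
  moreover have "568 / (real n)\<^sup>2 \<le> 568 / 30\<^sup>2" using assms by (intro frac_le power_mono) auto
  \<comment> \<open>Multiplying lower bounds needs a nonnegative base; 30 \<le> n ensures it, as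
    568/900 < 3/4.\<close>
  ultimately have pos: "0 \<le> 1 - ?c - 568 / (real n)\<^sup>2" by (simp add: power2_eq_square)
  have f: "1 - ?c - 568 / (real n)\<^sup>2 \<le> ?f i" "?f i \<le> 1 - ?c + 568 / (real n)\<^sup>2" if "i < n - 1" for i
    using r_shift[OF that] by linarith+
  have "(\<Prod>i<n-1. 1 - ?c - 568 / (real n)\<^sup>2) \<le> x" unfolding x
    using f pos by (intro prod_mono) auto
  then show "(1 - ?c - 568 / (real n)\<^sup>2) ^ (n - 1) \<le> x" by simp
  have "x \<le> (\<Prod>i<n-1. 1 - ?c + 568 / (real n)\<^sup>2)" unfolding x
    using f order_trans[OF pos f(1)] by (intro prod_mono) auto
  then show "x \<le> (1 - ?c + 568 / (real n)\<^sup>2) ^ (n - 1)" by simp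
qed

end

section \<open>Limits\<close>

text \<open>By symmetry only k \<le> n/2 matters, where n^k exp(-l k(n - k)) has logarithm k(ln n -
  l(n - k)). For k \<le> n/6 the bracket is at most ln n - 5ln/6 with \<open>ln\<close> meaning l
  times n, and k may be lowered to j. For larger k it is at most ln n minus half of l times n, and k
  \<ge> 5 because 30 \<le> n; the rates match since 5/2 = 5/6 * 3 and j \<le> 3.\<close>

lemma binomial_sum_bound:
  fixes l :: real
  assumes l: "l > 0" and j: "j \<le> 3"
  shows "\<forall>\<^sub>F n in sequentially. (\<Sum>k=j..n-j. real (n choose k) * exp (- l) ^ (k * (n - k)))
    \<le> (real n + 1) * (real n ^ 5 * exp (- (5 / 6 * real j * l * real n)))"
proof -
  have "\<forall>\<^sub>F n in sequentially. ln (real n) - l * (real n / 2) \<le> 0" using l by real_asymp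
  moreover have "\<forall>\<^sub>F n in sequentially. n \<ge> (30 :: nat)" by (rule eventually_ge_at_top)
  ultimately show ?thesis
  proof eventually_elim
    case (elim n)
    let ?B = "real n ^ 5 * exp (- (5 / 6 * real j * l * real n))"
    let ?X = "ln (real n)"
    have X0: "0 \<le> ?X" using elim by simp
    have ln: "0 \<le> l * real n" using l by simp
    have small: "real (n choose k) * exp (- l) ^ (k * (n - k)) \<le> ?B" if k: "j \<le> k" "2 * k \<le> n" for k
    proof -
      have nk: "real (n - k) = real n - real k" using k by simp
      have "real k * (?X - l * (real n - real k)) \<le> 5 * ?X - 5 / 6 * real j * l * real n"
      proof (cases "6 * k \<le> n")
        case True
        have "l * (5 / 6 * real n) \<le> l * (real n - real k)" using True l by (intro mult_left_mono) linarith+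
        then have a: "?X - l * (real n - real k) \<le> ?X - l * (5 / 6 * real n)" by linarith
        have b: "?X - l * (5 / 6 * real n) \<le> 0" using elim(1) ln by linarith
        have "real k * (?X - l * (real n - real k)) \<le> real k * (?X - l * (5 / 6 * real n))"
          using a by (rule mult_left_mono) simp
        also have "\<dots> \<le> real j * (?X - l * (5 / 6 * real n))"
          using b k by (intro mult_right_mono_neg) auto
        also have "\<dots> = real j * ?X - 5 / 6 * real j * l * real n" by (simp add: algebra_simps)
        also have "real j * ?X \<le> 5 * ?X" using j X0 by (intro mult_right_mono) auto
        finally show ?thesis by simp
      next
        case False
        have "l * (real n / 2) \<le> l * (real n - real k)" using k l by (intro mult_left_mono) linarith+
        then have a: "?X - l * (real n - real k) \<le> ?X - l * (real n / 2)" by linarith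
        have "real k * (?X - l * (real n - real k)) \<le> real k * (?X - l * (real n / 2))"
          using a by (rule mult_left_mono) simp
        also have "\<dots> \<le> 5 * (?X - l * (real n / 2))"
          using elim False by (intro mult_right_mono_neg) auto
        also have "\<dots> = 5 * ?X - 5 / 6 * 3 * (l * real n)" by (simp add: algebra_simps)
        also have "\<dots> \<le> 5 * ?X - 5 / 6 * real j * (l * real n)"
          using j ln by (intro diff_left_mono mult_right_mono) auto
        finally show ?thesis by (simp only: mult.assoc)
      qed
      then have "exp (real k * (?X - l * (real n - real k))) \<le> exp (5 * ?X - 5 / 6 * real j * l * real n)"
        by simp
      also have "\<dots> = exp (5 * ?X) * exp (- (5 / 6 * real j * l * real n))" by (simp flip: exp_add)
      also have "exp (5 * ?X) = real n ^ 5" using exp_of_nat_mult[of 5 ?X] elim(2) by simp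
      finally have le: "exp (real k * (?X - l * (real n - real k))) \<le> ?B" .
      have "real (n choose k) \<le> real n ^ k"
        using binomial_le_pow[of k n] k by (simp flip: of_nat_power)
      then have "real (n choose k) * exp (- l) ^ (k * (n - k)) \<le> real n ^ k * exp (- l) ^ (k * (n - k))"
        by (intro mult_right_mono) auto
      also have "real n ^ k * exp (- l) ^ (k * (n - k)) = exp (real k * (?X - l * (real n - real k)))"
      proof -
        have "real n ^ k = exp (real k * ?X)" using elim by (simp add: exp_of_nat_mult)
        moreover have "exp (- l) ^ (k * (n - k)) = exp (real k * (real n - real k) * - l)"
          using exp_of_nat_mult[of "k * (n - k)" "- l"] by (simp add: nk)
        ultimately show ?thesis by (simp add: algebra_simps flip: exp_add)
      qed
      finally show ?thesis using le by linarith
    qed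
    have "real (n choose k) * exp (- l) ^ (k * (n - k)) \<le> ?B" if k: "k \<in> {j..n-j}" for k
    proof (cases "2 * k \<le> n")
      case True
      then show ?thesis using small k by simp
    next
      case False
      have "k \<le> n" using k by auto
      then have "n - (n - k) = k" "j \<le> n - k" "2 * (n - k) \<le> n" using k False by auto
      then show ?thesis
        using small[of "n - k"] binomial_symmetric[OF \<open>k \<le> n\<close>] by (simp add: mult.commute[of k])
    qed
    then have "(\<Sum>k=j..n-j. real (n choose k) * exp (- l) ^ (k * (n - k))) \<le> (\<Sum>k=j..n-j. ?B)"
      by (rule sum_mono)
    also have "\<dots> = real (card {j..n-j}) * ?B" by simp
    also have "\<dots> \<le> (real n + 1) * ?B" by (intro mult_right_mono) auto
    finally show ?case .
  qed
qed

lemma scaled_limit: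
  fixes P E G h :: "nat \<Rightarrow> real"
  assumes "(\<lambda>n. E n / h n) \<longlonglongrightarrow> 0" "\<forall>\<^sub>F n in sequentially. \<bar>P n - G n\<bar> \<le> E n \<and> 0 < h n"
    and "(\<lambda>n. G n / h n) \<longlonglongrightarrow> x"
  shows "(\<lambda>n. P n / h n) \<longlonglongrightarrow> x"
proof -
  have "(\<lambda>n. P n / h n - G n / h n) \<longlonglongrightarrow> 0"
  proof (rule Lim_null_comparison)
    show "\<forall>\<^sub>F n in sequentially. norm (P n / h n - G n / h n) \<le> E n / h n"
      using assms(2)
      by eventually_elim (simp add: divide_right_mono flip: diff_divide_distrib)
  qed (fact assms(1))
  from tendsto_add[OF this assms(3)] show ?thesis by simp
qed

section \<open>Asymptotics along the edge numbers of the theorem\<close>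

context
  fixes p :: real and M :: "nat \<Rightarrow> nat" and H :: "nat \<Rightarrow> nat \<Rightarrow> real" and Q :: "nat \<Rightarrow> real"
    and P :: "nat \<Rightarrow> nat pair_pre_digraph set \<Rightarrow> real" and q c :: real
  assumes p: "0 < p" "p < 1"
  defines "M \<equiv> \<lambda>n. nat \<lfloor>p * real (n choose 2)\<rfloor>"
    and "H \<equiv> \<lambda>n K. half_prob (n choose 2) (M n) K"
    and "Q \<equiv> \<lambda>n. 1 - real (M n) / real (n choose 2) / 2"
    and "P \<equiv> \<lambda>n. measure_pmf.prob (random_dgraph n (M n))"
    and "q \<equiv> 1 - p / 2" and "c \<equiv> 2 * (p * (1 - p) / (2 - p)\<^sup>2)"
begin

lemma M_bounds: "real (M n) \<le> p * real (n choose 2)" "p * real (n choose 2) \<le> real (M n) + 1"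
  using p by (auto simp: M_def)

lemma M_le: "M n \<le> n choose 2"
proof -
  have "p * real (n choose 2) \<le> 1 * real (n choose 2)" using p by (intro mult_right_mono) auto
  then have "real (M n) \<le> real (n choose 2)" using M_bounds[of n] by linarith
  then show ?thesis by simp
qed

text \<open>Identifies 2\<kappa>/q from the ratio estimates with the exponent in the
  theorem.\<close>

lemma c_eq: "2 * (p * (1 - p) / (2 * (2 - p))) / (1 - p / 2) = c"
proof -
  define x where "x = 2 - p"
  have x: "1 - p / 2 = x / 2" "2 - p = x" by (simp_all add: x_def)
  show ?thesis unfolding c_def x by (simp add: power2_eq_square)
qed

lemma H_double_limit: "(\<lambda>n. H n (2 * n - 2) / (H n (n - 1))\<^sup>2) \<longlonglongrightarrow> exp (- c)"
proof (rule tendsto_sandwich)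
  have c0: "c \<ge> 0" using p by (simp add: c_def)
  \<comment> \<open>A real exponent brings the expression into the scope of
    \<open>real_asymp\<close>.\<close>
  have pw: "(1 - c / real n + C / (real n)\<^sup>2) ^ (n - 1) = (1 - c / real n + C / (real n)\<^sup>2) powr (real n - 1)"
    if "n > 0" "1 - c / real n + C / (real n)\<^sup>2 > 0" for n C
    using that powr_realpow[OF that(2), of "n - 1"] by (simp add: of_nat_diff)
  have lim: "(\<lambda>n. (1 - c / real n + C / (real n)\<^sup>2) ^ (n - 1)) \<longlonglongrightarrow> exp (- c)" for C
  proof (rule Lim_transform_eventually)
    show "(\<lambda>n. (1 - c / real n + C / (real n)\<^sup>2) powr (real n - 1)) \<longlonglongrightarrow> exp (- c)" by real_asymp
    have "\<forall>\<^sub>F n in sequentially. 1 - c / real n + C / (real n)\<^sup>2 > 0" by real_asymp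
    with eventually_gt_at_top[of 0]
    show "\<forall>\<^sub>F n in sequentially. (1 - c / real n + C / (real n)\<^sup>2) powr (real n - 1) =
        (1 - c / real n + C / (real n)\<^sup>2) ^ (n - 1)"
      by eventually_elim (simp only: pw)
  qed
  show "(\<lambda>n. (1 - c / real n - 568 / (real n)\<^sup>2) ^ (n - 1)) \<longlonglongrightarrow> exp (- c)"
    using lim[of "- 568"] by simp
  show "(\<lambda>n. (1 - c / real n + 568 / (real n)\<^sup>2) ^ (n - 1)) \<longlonglongrightarrow> exp (- c)" by (rule lim)
  show "\<forall>\<^sub>F n in sequentially. (1 - c / real n - 568 / (real n)\<^sup>2) ^ (n - 1) \<le> H n (2 * n - 2) / (H n (n - 1))\<^sup>2"
    using eventually_ge_at_top[of 30]
  proof eventually_elim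
    case (elim n)
    then show ?case using half_prob_double_bounds(1)[OF p _ M_bounds[of n]]
      unfolding H_def c_eq by simp
  qed
  show "\<forall>\<^sub>F n in sequentially. H n (2 * n - 2) / (H n (n - 1))\<^sup>2 \<le> (1 - c / real n + 568 / (real n)\<^sup>2) ^ (n - 1)"
    using eventually_ge_at_top[of 30]
  proof eventually_elim
    case (elim n)
    then show ?case using half_prob_double_bounds(2)[OF p _ M_bounds[of n]]
      unfolding H_def c_eq by simp
  qed
qed

lemma q_pos: "0 < q" "q < 1" using p by (auto simp: q_def)

lemma half_ratio_approx:
  assumes "10 \<le> n" "K \<le> 2 * n"
  shows "\<bar>half_ratio (n choose 2) (M n) K - q\<bar> \<le> 8 / real n"
  using r_first_order[OF p assms(1) M_bounds assms(2)] by (simp add: q_def)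

lemma two_n_le_N: "10 \<le> n \<Longrightarrow> 2 * n < n choose 2"
  using N_minus_ge(2)[OF p _ M_bounds, of n "2 * n"] by simp

lemma half_ratio_limit:
  assumes "\<forall>\<^sub>F n in sequentially. f n \<le> 2 * n"
  shows "(\<lambda>n. half_ratio (n choose 2) (M n) (f n)) \<longlonglongrightarrow> q"
proof (rule LIM_zero_cancel, rule Lim_null_comparison)
  show "\<forall>\<^sub>F n in sequentially. norm (half_ratio (n choose 2) (M n) (f n) - q) \<le> 8 / real n"
    using assms eventually_ge_at_top[of 10]
    by eventually_elim (simp only: real_norm_def half_ratio_approx)
  show "(\<lambda>n. 8 / real n) \<longlonglongrightarrow> 0" by real_asymp
qed

lemma H_pos: "10 \<le> n \<Longrightarrow> K \<le> 2 * n \<Longrightarrow> H n K > 0"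
  unfolding H_def using two_n_le_N[of n] by (intro half_prob_pos M_le) auto

lemma H_base_pos: "10 \<le> n \<Longrightarrow> H n (n - 1) > 0"
  by (rule H_pos) auto

text \<open>Lowering the index by one divides by a ratio that tends to \<open>q\<close>; this is the
  gain from each shared arc.\<close>

lemma H_limits:
  "(\<lambda>n. H n (2 * n - 3) / (H n (n - 1))\<^sup>2) \<longlonglongrightarrow> exp (- c) / q"
  "(\<lambda>n. H n (2 * n - 4) / (H n (n - 1))\<^sup>2) \<longlonglongrightarrow> exp (- c) / q / q"
proof -
  have step: "(\<lambda>n. H n (2 * n - k) / (H n (n - 1))\<^sup>2) \<longlonglongrightarrow> L / q"
    if L: "(\<lambda>n. H n (2 * n - (k - 1)) / (H n (n - 1))\<^sup>2) \<longlonglongrightarrow> L" and k: "1 \<le> k" "k \<le> 4" for k L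
  proof (rule Lim_transform_eventually)
    show "(\<lambda>n. H n (2 * n - (k - 1)) / (H n (n - 1))\<^sup>2 / half_ratio (n choose 2) (M n) (2 * n - k)) \<longlonglongrightarrow> L / q"
      using q_pos by (intro tendsto_divide L half_ratio_limit) auto
    show "\<forall>\<^sub>F n in sequentially. H n (2 * n - (k - 1)) / (H n (n - 1))\<^sup>2 / half_ratio (n choose 2) (M n) (2 * n - k) =
        H n (2 * n - k) / (H n (n - 1))\<^sup>2"
      using eventually_ge_at_top[of 10]
    proof eventually_elim
      case (elim n)
      have "Suc (2 * n - k) = 2 * n - (k - 1)" using elim k by simp
      then have r: "half_ratio (n choose 2) (M n) (2 * n - k) = H n (2 * n - (k - 1)) / H n (2 * n - k)"
        by (simp only: half_ratio_def H_def)
      have "H n (2 * n - (k - 1)) > 0" "H n (2 * n - k) > 0" using elim k by (auto intro!: H_pos)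
      then show ?case unfolding r by simp
    qed
  qed
  show 1: "(\<lambda>n. H n (2 * n - 3) / (H n (n - 1))\<^sup>2) \<longlonglongrightarrow> exp (- c) / q"
    by (rule step) (use H_double_limit in auto)
  show "(\<lambda>n. H n (2 * n - 4) / (H n (n - 1))\<^sup>2) \<longlonglongrightarrow> exp (- c) / q / q"
    by (rule step) (use 1 in auto)
qed

text \<open>Every ratio involved is within 8/n of \<open>q\<close>, hence eventually above \<theta>.
  Only the exponential rate matters for the error terms.\<close>

lemma H_lower:
  assumes "0 \<le> \<theta>" "\<theta> < q"
  shows "\<forall>\<^sub>F n in sequentially. \<theta> ^ (n - 1) \<le> H n (n - 1)"
proof -
  have "\<forall>\<^sub>F n in sequentially. \<theta> \<le> q - 8 / real n" using assms by real_asymp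
  with eventually_ge_at_top[of 10] show ?thesis
  proof eventually_elim
    case (elim n)
    have "(\<Prod>i<n-1. \<theta>) \<le> (\<Prod>i<n-1. half_ratio (n choose 2) (M n) i)"
    proof (rule prod_mono)
      fix i assume "i \<in> {..<n-1}"
      then have "\<bar>half_ratio (n choose 2) (M n) i - q\<bar> \<le> 8 / real n"
        using elim by (intro half_ratio_approx) auto
      then show "0 \<le> \<theta> \<and> \<theta> \<le> half_ratio (n choose 2) (M n) i" using elim assms by linarith
    qed
    also have "\<dots> = H n (0 + (n - 1))"
      using half_prob_add[OF M_le, of 0 "n - 1" n] two_n_le_N[of n] elim
      by (simp add: H_def half_prob_0[OF M_le])
    finally show ?case by simp
  qed
qed

lemma density_limit: "Q \<longlonglongrightarrow> q"
proof -
  have "(\<lambda>n. real (M n) / real (n choose 2)) \<longlonglongrightarrow> p"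
  proof (rule LIM_zero_cancel, rule Lim_null_comparison)
    show "\<forall>\<^sub>F n in sequentially. norm (real (M n) / real (n choose 2) - p) \<le> 1 / real n"
      using eventually_ge_at_top[of 10]
    proof eventually_elim
      case (elim n)
      have N: "real n \<le> real (n choose 2)" "0 < real n" using two_n_le_N[OF elim] elim by auto
      have "real (n choose 2) * (real (M n) / real (n choose 2) - p) = real (M n) - p * real (n choose 2)"
      proof -
        have "real (n choose 2) \<noteq> 0" using N by linarith
        from nonzero_mult_div_cancel_left[OF this] show ?thesis
          by (simp only: right_diff_distrib times_divide_eq_right mult.commute[of p])
      qed
      then have "\<bar>real (n choose 2) * (real (M n) / real (n choose 2) - p)\<bar> \<le> 1"
        using M_bounds[of n] by linarith
      then show ?case using abs_le_divide[OF N(2,1)] by simp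
    qed
    show "(\<lambda>n. 1 / real n) \<longlonglongrightarrow> 0" by real_asymp
  qed
  then show ?thesis unfolding q_def Q_def by (intro tendsto_intros) auto
qed

lemma density_q_nonneg: "0 \<le> Q n"
proof -
  have "real (M n) / real (n choose 2) \<le> 1" using M_le[of n] by (simp add: divide_le_eq_1) linarith
  moreover have "0 \<le> 1 - x / 2" if "x \<le> 1" for x :: real using that by simp
  ultimately show ?thesis unfolding Q_def by blast
qed

text \<open>The strict inequality between \<open>q\<close> and \<open>exp (- l)\<close> absorbs the
  deviation of the exact density from \<open>p\<close>.\<close>

lemma density_q_sum_bound:
  assumes "l > 0" "j \<le> 3" "q < exp (- l)"
  shows "\<forall>\<^sub>F n in sequentially. Q n \<le> exp (- l) \<and>
    (\<Sum>k=j..n-j. real (n choose k) * Q n ^ (k * (n - k)))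
      \<le> (real n + 1) * (real n ^ 5 * exp (- (5 / 6 * real j * l * real n)))"
proof -
  have "\<forall>\<^sub>F n in sequentially. Q n < exp (- l)"
    using order_tendstoD(2)[OF density_limit assms(3)] .
  with binomial_sum_bound[OF assms(1,2)] show ?thesis
  proof eventually_elim
    case (elim n)
    have "(\<Sum>k=j..n-j. real (n choose k) * Q n ^ (k * (n - k))) \<le>
        (\<Sum>k=j..n-j. real (n choose k) * exp (- l) ^ (k * (n - k)))"
      using elim(2) density_q_nonneg by (intro sum_mono mult_left_mono power_mono) auto
    with elim show ?case by linarith
  qed
qed

lemma choose_2_le: "2 \<le> n \<Longrightarrow> real ((n choose 2) + 1) \<le> real n ^ 2 + 1"
  using binomial_le_pow[of 2 n] by (simp flip: of_nat_power)

lemma exp_power_eq: "exp (- l) ^ k = exp (- (l * real k))" for l :: real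
  using exp_of_nat_mult[of k "- l"] by (simp add: mult.commute)

lemma error_limits:
  "(\<lambda>n. 2 * real ((n choose 2) + 1) * ((\<Sum>k=2..n-2. real (n choose k) * Q n ^ (k * (n - k)))
      + Q n ^ (2 * n - 3)) / H n (n - 1)) \<longlonglongrightarrow> 0" (is "?A \<longlonglongrightarrow> 0")
  "(\<lambda>n. 4 * real ((n choose 2) + 1) * ((\<Sum>k=3..n-3. real (n choose k) * Q n ^ (k * (n - k)))
      + real n ^ 4 * Q n ^ (3 * n - 9)) / (H n (n - 1))\<^sup>2) \<longlonglongrightarrow> 0" (is "?B \<longlonglongrightarrow> 0")
proof -
  \<comment> \<open>The rates \<open>19/20\<close> and \<open>11/10\<close> leave room on both sides: \<open>5/6 * 2 * 19/20 > 11/10\<close> and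
    \<open>5/6 * 3 * 19/20 > 2 * 11/10\<close>.\<close>
  define L where "L = - ln q"
  have L: "L > 0" "q = exp (- L)" using q_pos by (simp_all add: L_def)
  define l where "l = 19 / 20 * L"
  define \<theta> where "\<theta> = exp (- (11 / 10 * L))"
  have l: "l > 0" "q < exp (- l)" using L by (simp_all add: l_def)
  have \<theta>: "0 < \<theta>" "\<theta> < q" "\<theta> < 1" using L by (simp_all add: \<theta>_def)
  have H_ge: "\<forall>\<^sub>F n in sequentially. exp (- (11 / 10 * L * real n)) \<le> H n (n - 1)"
  proof (rule eventually_mono)
    show "\<forall>\<^sub>F n in sequentially. \<theta> ^ (n - 1) \<le> H n (n - 1)"
      using \<theta> by (intro H_lower) auto
    fix n assume "\<theta> ^ (n - 1) \<le> H n (n - 1)"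
    moreover have "\<theta> ^ n \<le> \<theta> ^ (n - 1)" using \<theta> by (intro power_decreasing) auto
    moreover have "\<theta> ^ n = exp (- (11 / 10 * L * real n))" by (simp only: \<theta>_def exp_power_eq)
    ultimately show "exp (- (11 / 10 * L * real n)) \<le> H n (n - 1)" by linarith
  qed
  show "?A \<longlonglongrightarrow> 0"
  proof (rule Lim_null_comparison)
    show "(\<lambda>n. 2 * (real n ^ 2 + 1) * ((real n + 1) * (real n ^ 5 * exp (- (5 / 6 * real 2 * (19 / 20 * L) * real n)))
        + exp (- (19 / 20 * L * (2 * real n - 3)))) / exp (- (11 / 10 * L * real n))) \<longlonglongrightarrow> 0"
      using L(1) by real_asymp
    show "\<forall>\<^sub>F n in sequentially. norm (?A n) \<le> 2 * (real n ^ 2 + 1) * ((real n + 1) * (real n ^ 5 * exp (- (5 / 6 * real 2 * (19 / 20 * L) * real n)))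
        + exp (- (19 / 20 * L * (2 * real n - 3)))) / exp (- (11 / 10 * L * real n))"
      using density_q_sum_bound[OF l(1) _ l(2), of 2, simplified] H_ge eventually_ge_at_top[of 10]
    proof eventually_elim
      case (elim n)
      let ?S = "\<Sum>k=2..n-2. real (n choose k) * Q n ^ (k * (n - k))"
      have S: "0 \<le> ?S" by (intro sum_nonneg mult_nonneg_nonneg zero_le_power density_q_nonneg) simp
      have "Q n ^ (2 * n - 3) \<le> exp (- l) ^ (2 * n - 3)"
        using elim(1) density_q_nonneg by (intro power_mono) auto
      also have "\<dots> = exp (- (19 / 20 * L * (2 * real n - 3)))"
        using elim(3) by (simp add: exp_power_eq l_def of_nat_diff)
      finally have 1: "Q n ^ (2 * n - 3) \<le> exp (- (19 / 20 * L * (2 * real n - 3)))" .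
      have 2: "?S \<le> (real n + 1) * (real n ^ 5 * exp (- (5 / 6 * real 2 * (19 / 20 * L) * real n)))"
        using elim(1) by (simp add: l_def)
      have "?A n \<ge> 0" using S elim density_q_nonneg[of n] H_base_pos[of n]
        by (intro divide_nonneg_nonneg mult_nonneg_nonneg add_nonneg_nonneg zero_le_power) auto
      then have "norm (?A n) = ?A n" by (simp only: real_norm_def abs_of_nonneg)
      also have "?A n \<le> 2 * (real n ^ 2 + 1) * ((real n + 1) * (real n ^ 5 * exp (- (5 / 6 * real 2 * (19 / 20 * L) * real n)))
        + exp (- (19 / 20 * L * (2 * real n - 3)))) / exp (- (11 / 10 * L * real n))"
        using S elim 1 2 choose_2_le[of n] density_q_nonneg[of n]
        by (intro frac_le mult_mono add_mono mult_nonneg_nonneg add_nonneg_nonneg zero_le_power) auto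
      finally show ?case .
    qed
  qed
  show "?B \<longlonglongrightarrow> 0"
  proof (rule Lim_null_comparison)
    show "(\<lambda>n. 4 * (real n ^ 2 + 1) * ((real n + 1) * (real n ^ 5 * exp (- (5 / 6 * real 3 * (19 / 20 * L) * real n)))
        + real n ^ 4 * exp (- (19 / 20 * L * (3 * real n - 9)))) / (exp (- (11 / 10 * L * real n)))\<^sup>2) \<longlonglongrightarrow> 0"
      using L(1) by real_asymp
    show "\<forall>\<^sub>F n in sequentially. norm (?B n) \<le> 4 * (real n ^ 2 + 1) * ((real n + 1) * (real n ^ 5 * exp (- (5 / 6 * real 3 * (19 / 20 * L) * real n)))
        + real n ^ 4 * exp (- (19 / 20 * L * (3 * real n - 9)))) / (exp (- (11 / 10 * L * real n)))\<^sup>2"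
      using density_q_sum_bound[OF l(1) _ l(2), of 3, simplified] H_ge eventually_ge_at_top[of 10]
    proof eventually_elim
      case (elim n)
      let ?S = "\<Sum>k=3..n-3. real (n choose k) * Q n ^ (k * (n - k))"
      have S: "0 \<le> ?S" by (intro sum_nonneg mult_nonneg_nonneg zero_le_power density_q_nonneg) simp
      have "Q n ^ (3 * n - 9) \<le> exp (- l) ^ (3 * n - 9)"
        using elim(1) density_q_nonneg by (intro power_mono) auto
      also have "\<dots> = exp (- (19 / 20 * L * (3 * real n - 9)))"
        using elim(3) by (simp add: exp_power_eq l_def of_nat_diff)
      finally have 1: "Q n ^ (3 * n - 9) \<le> exp (- (19 / 20 * L * (3 * real n - 9)))" .
      have 2: "?S \<le> (real n + 1) * (real n ^ 5 * exp (- (5 / 6 * real 3 * (19 / 20 * L) * real n)))"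
        using elim(1) by (simp add: l_def)
      have "?B n \<ge> 0" using S density_q_nonneg[of n] H_base_pos[OF elim(3)]
        by (intro divide_nonneg_nonneg mult_nonneg_nonneg add_nonneg_nonneg zero_le_power) auto
      then have "norm (?B n) = ?B n" by (simp only: real_norm_def abs_of_nonneg)
      also have "?B n \<le> 4 * (real n ^ 2 + 1) * ((real n + 1) * (real n ^ 5 * exp (- (5 / 6 * real 3 * (19 / 20 * L) * real n)))
        + real n ^ 4 * exp (- (19 / 20 * L * (3 * real n - 9)))) / (exp (- (11 / 10 * L * real n)))\<^sup>2"
        using S elim 1 2 choose_2_le[of n] density_q_nonneg[of n]
        by (intro frac_le mult_mono add_mono power_mono mult_nonneg_nonneg add_nonneg_nonneg zero_le_power) auto
      finally show ?case .
    qed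
  qed
qed

lemma prob_no_dipath_limit:
  assumes "a \<noteq> s" "1 \<le> a" "1 \<le> s"
  shows "(\<lambda>n. P n (no_dipath s a) / H n (n - 1)) \<longlonglongrightarrow> 2"
proof (rule scaled_limit[OF error_limits(1)])
  show "\<forall>\<^sub>F n in sequentially. \<bar>P n (no_dipath s a) - 2 * H n (n - 1)\<bar> \<le>
      2 * real ((n choose 2) + 1) * ((\<Sum>k=2..n-2. real (n choose k) * Q n ^ (k * (n - k))) + Q n ^ (2 * n - 3))
      \<and> 0 < H n (n - 1)"
    using eventually_ge_at_top[of "max 10 (max a s)"]
  proof eventually_elim
    case (elim n)
    then show ?case using prob_no_dipath_approx[of n "M n" s a] M_le assms H_base_pos[of n]
      by (simp add: P_def H_def Q_def)
  qed
  show "(\<lambda>n. 2 * H n (n - 1) / H n (n - 1)) \<longlonglongrightarrow> 2"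
  proof (rule Lim_transform_eventually[OF tendsto_const])
    show "\<forall>\<^sub>F n in sequentially. 2 = 2 * H n (n - 1) / H n (n - 1)"
      using eventually_ge_at_top[of 10]
    proof eventually_elim
      case (elim n)
      then show ?case using H_base_pos[of n] by simp
    qed
  qed
qed

lemma prob_no_dipath_Int_limit:
  assumes "distinct [a, s, b, t]" "1 \<le> a" "1 \<le> s" "1 \<le> b" "1 \<le> t"
  shows "(\<lambda>n. P n (no_dipath s a \<inter> no_dipath t b) / (H n (n - 1))\<^sup>2)
    \<longlonglongrightarrow> 2 * (exp (- c) / q / q + exp (- c) / q)"
proof (rule scaled_limit[OF error_limits(2)])
  show "\<forall>\<^sub>F n in sequentially. \<bar>P n (no_dipath s a \<inter> no_dipath t b) - 2 * (H n (2 * n - 4) + H n (2 * n - 3))\<bar> \<le>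
      4 * real ((n choose 2) + 1) * ((\<Sum>k=3..n-3. real (n choose k) * Q n ^ (k * (n - k)))
        + real n ^ 4 * Q n ^ (3 * n - 9)) \<and> 0 < (H n (n - 1))\<^sup>2"
    using eventually_ge_at_top[of "max 10 (max (max a s) (max b t))"]
  proof eventually_elim
    case (elim n)
    then have "{a, s, b, t} \<subseteq> {1..n}" "8 \<le> n" "2 \<le> n" using assms by auto
    then show ?case using prob_no_dipath_Int_approx[OF _ M_le _ assms(1)] H_base_pos[of n] elim
      unfolding P_def H_def Q_def by auto
  qed
  show "(\<lambda>n. 2 * (H n (2 * n - 4) + H n (2 * n - 3)) / (H n (n - 1))\<^sup>2)
      \<longlonglongrightarrow> 2 * (exp (- c) / q / q + exp (- c) / q)"
    using tendsto_mult_left[OF tendsto_add[OF H_limits(2,1)], of 2]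
    by (simp add: add_divide_distrib)
qed

text \<open>From p^2 \<ge> 0 follows c \<le> p/2, and q = 1 - p/2 \<le> exp(-p/2), so q exp c \<le>
  1; then 2q < 1 + q gives strictness. This yields both positive correlation and a nonzero
  limit.\<close>

lemma correlation_constant_less_1: "2 * q\<^sup>2 / (1 + q) * exp c < 1"
proof -
  have "4 * (1 - p) \<le> (2 - p)\<^sup>2" by (simp add: power2_eq_square algebra_simps)
  then have "p * (4 * (1 - p)) \<le> p * (2 - p)\<^sup>2" using p by (intro mult_left_mono) auto
  moreover have "(2 - p)\<^sup>2 > 0" using p by simp
  ultimately have "c \<le> p / 2" by (simp add: c_def field_simps)
  then have "exp c \<le> exp (p / 2)" by simp
  moreover have "q * exp (p / 2) \<le> 1"
  proof -
    have "q \<le> exp (- (p / 2))" using exp_ge_add_one_self[of "- (p / 2)"] by (simp add: q_def)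
    then have "q * exp (p / 2) \<le> exp (- (p / 2)) * exp (p / 2)" by (intro mult_right_mono) auto
    then show ?thesis by (simp flip: exp_add)
  qed
  ultimately have "q * exp c \<le> 1"
    using q_pos mult_left_mono[of "exp c" "exp (p / 2)" q] by linarith
  then have "2 * q * (q * exp c) \<le> 2 * q * 1" using q_pos by (intro mult_left_mono) auto
  also have "\<dots> < 1 + q" using q_pos by simp
  finally show ?thesis using q_pos by (simp add: power2_eq_square field_simps)
qed

lemma correlation:
  assumes "distinct [a, s, b, t]" "1 \<le> a" "1 \<le> s" "1 \<le> b" "1 \<le> t"
  defines "A \<equiv> no_dipath s a" and "B \<equiv> no_dipath t b"
  shows "\<forall>\<^sub>F n in sequentially. P n (A \<inter> B) > P n A * P n B" (is ?pos)
    and "(\<lambda>n. (P n (A \<inter> B) - P n A * P n B) / P n (A \<inter> B)) \<longlonglongrightarrow>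
      1 - 2 * q\<^sup>2 / (1 + q) * exp c" (is "?f \<longlonglongrightarrow> ?K")
proof -
  define x where "x = 2 * (exp (- c) / q / q + exp (- c) / q)"
  have x: "x > 0" using q_pos by (simp add: x_def add_pos_pos)
  have lim: "(\<lambda>n. P n (A \<inter> B) / (H n (n - 1))\<^sup>2) \<longlonglongrightarrow> x"
    unfolding A_def B_def x_def by (rule prob_no_dipath_Int_limit[OF assms(1-5)])
  have limA: "(\<lambda>n. P n A / H n (n - 1)) \<longlonglongrightarrow> 2" and limB: "(\<lambda>n. P n B / H n (n - 1)) \<longlonglongrightarrow> 2"
    unfolding A_def B_def using assms(1-5) prob_no_dipath_limit[of a s] prob_no_dipath_limit[of b t] by auto
  have pos: "\<forall>\<^sub>F n in sequentially. 0 < P n (A \<inter> B)"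
    using order_tendstoD(1)[OF lim x] eventually_ge_at_top[of 10]
  proof eventually_elim
    case (elim n)
    then show ?case using H_base_pos[of n] by (simp add: zero_less_divide_iff)
  qed
  have "?f \<longlonglongrightarrow> 1 - 2 * 2 / x"
  proof (rule Lim_transform_eventually)
    show "(\<lambda>n. 1 - P n A / H n (n - 1) * (P n B / H n (n - 1)) / (P n (A \<inter> B) / (H n (n - 1))\<^sup>2)) \<longlonglongrightarrow> 1 - 2 * 2 / x"
      using x by (intro tendsto_intros limA limB lim) auto
    show "\<forall>\<^sub>F n in sequentially. 1 - P n A / H n (n - 1) * (P n B / H n (n - 1)) / (P n (A \<inter> B) / (H n (n - 1))\<^sup>2) = ?f n"
      using pos eventually_ge_at_top[of 10]
    proof eventually_elim
      case (elim n)
      then show ?case using H_base_pos[of n] by (simp add: diff_divide_distrib power2_eq_square)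
    qed
  qed
  also have "2 * 2 / x = 2 * q\<^sup>2 / (1 + q) * exp c"
    using q_pos by (simp add: x_def exp_minus field_simps power2_eq_square)
  finally show lim_f: "?f \<longlonglongrightarrow> ?K" .
  \<comment> \<open>A positive limit and an eventually positive denominator force the numerator, the
    covariance, to be eventually positive.\<close>
  have "?K > 0" using correlation_constant_less_1 by simp
  from order_tendstoD(1)[OF lim_f this] pos show ?pos
    by eventually_elim (simp add: zero_less_divide_iff)
qed

end

theorem theorem4p4:
  fixes p :: real and a s b t :: nat
    and m :: "nat \<Rightarrow> nat" and Pr :: "nat \<Rightarrow> nat pair_pre_digraph set \<Rightarrow> real"
    and A B :: "nat pair_pre_digraph set"
  assumes "0 < p" and "p < 1"
    and "distinct [a, s, b, t]" and "1 \<le> a" and "1 \<le> s" and "1 \<le> b" and "1 \<le> t"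
  defines "m \<equiv> \<lambda>n. nat \<lfloor>p * real (n choose 2)\<rfloor>"
    and "Pr \<equiv> \<lambda>n. measure_pmf.prob (random_dgraph n (m n))"
    and "A \<equiv> no_dipath s a" and "B \<equiv> no_dipath t b"
  shows "(\<forall>\<^sub>F n in sequentially. Pr n (A \<inter> B) > Pr n A * Pr n B) \<and>
    (\<lambda>n. (Pr n (A \<inter> B) - Pr n A * Pr n B) / Pr n (A \<inter> B)) \<sim>[sequentially]
      (\<lambda>n. 1 - 2 * (1 - p / 2)\<^sup>2 / (2 - p / 2) * exp (2 * (p * (1 - p) / (2 - p)\<^sup>2)))"
proof
  show "\<forall>\<^sub>F n in sequentially. Pr n (A \<inter> B) > Pr n A * Pr n B"
    unfolding Pr_def m_def A_def B_def by (rule correlation(1)[OF assms(1-7)])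
  have q: "2 - p / 2 = 1 + (1 - p / 2)" by simp
  show "(\<lambda>n. (Pr n (A \<inter> B) - Pr n A * Pr n B) / Pr n (A \<inter> B)) \<sim>[sequentially]
      (\<lambda>n. 1 - 2 * (1 - p / 2)\<^sup>2 / (2 - p / 2) * exp (2 * (p * (1 - p) / (2 - p)\<^sup>2)))"
    unfolding Pr_def m_def A_def B_def q
  proof (intro tendsto_imp_asymp_equiv_const correlation(2)[OF assms(1-7)])
    \<comment> \<open>Convergence to a constant gives asymptotic equivalence to it only if the
      constant is nonzero.\<close>
    have "1 - x \<noteq> 0" if "x < 1" for x :: real using that by simp
    from this[OF correlation_constant_less_1[OF assms(1,2)]]
    show "1 - 2 * (1 - p / 2)\<^sup>2 / (1 + (1 - p / 2)) * exp (2 * (p * (1 - p) / (2 - p)\<^sup>2)) \<noteq> 0" .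
  qed
qed

end
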